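(* Let $A,B\subseteq\mathcal{V}_{w,\infty}$ and let $\mathcal{A}\subseteq\mathfrak{P}(\mathcal{V}_{w,\infty})$ be a family of subsets of $\mathcal{V}_{w,\infty}$. Then the following statements hold. 1. $\mathfrak{K}_{\bigcup\mathcal{A}} = \sup_{A\in\mathcal{A}} \mathfrak{K}_{A}$ (pointwise supremum), where $\bigcup\mathcal{A} := \bigcup_{A\in\mathcal{A}}A$. 2. $\mathfrak{K}_{A} = \mathfrak{K}_{\operatorname{cl}(A)}$. 3. The map $A\mapsto\mathfrak{K}_{A}$, $\mathfrak{C}(\mathcal{V}_{w,\infty}\setminus \{0\}) \to \mathcal{V}_{w^2,\infty}$, is continuous with respect to the Hausdorff metric. 4. For every $r>0$ the map $A\mapsto\mathfrak{K}_{A}$, $\mathfrak{P}(\mathcal{V}_{w,\infty}\setminus B(0,r)) \to \mathcal{V}_{w^2,\infty}$, is continuous with respect to the Hausdorff pseudometric. 5. The map $A\mapsto\mathfrak{K}_{A}$, $\operatorname{Cone}(\mathfrak{P}(\mathcal{V}_{w,\infty})) \to \mathcal{V}_{w^2,\infty}$, is continuous with respect to the truncated Hausdorff pseudometric. 6. If $A\perp B$, then $\mathfrak{K}_{A + B} \le \mathfrak{K}_{A} + \mathfrak{K}_{B}$. If moreover $A$ and $B$ are linear spaces, then equality holds. 7. If $A$ and $B$ are stochastically independent (element-wise), then $\mathfrak{K}_{A\cdot B} = \mathfrak{K}_{A} \cdot \mathfrak{K}_{B}$. 8. If $A$ and $B$ are linear spaces, then $\mathfrak{K}_{A\otimes B}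 = \mathfrak{K}_{A} \cdot \mathfrak{K}_{B}$.
   Context: Let $\rho$ be a probability measure on a set $Y$ and $\|\cdot\| := \|\cdot\|_{L^2(Y,\rho)}$. Let $w$ be a weight function on $Y$, i.e. $w>0$ almost everywhere and $\int_Y w^{-1}\,\mathrm{d}\rho=1$. Define $$\mathcal{V}_{w,\infty} := \{v\in L^\infty(Y,\rho) : \|v\|_{w,\infty}<\infty\},\qquad \|v\|_{w,\infty} := \operatorname{ess\,sup}_{y\in Y}\sqrt{w(y)}\,|v(y)|,$$ and define $\mathcal{V}_{w^2,\infty}$ and $\|\cdot\|_{w^2,\infty}$ in the same way with $w$ replaced by $w^2$ (so $\|v\|_{w^2,\infty}=\operatorname{ess\,sup}_y w(y)|v(y)|$). Functions are assumed to have point evaluations $v(y)$ at all $y\in Y$; (in)equalities between functions on $Y$ are pointwise. The variation function of $A\subseteq\mathcal{V}_{w,\infty}$ is $$\mathfrak{K}_A(y) := \sup_{a\in U(A)}|a(y)|^2,\qquad U(A) := \{u/\|u\| : u\in A\setminus\{0\}\}$$ (normalisation in the $L^2(Y,\rho)$-norm); the same formula is used for sets of products of such functions. $\mathfrak{P}(X)$ is the set of all subsets of $X$; $\mathfrak{C}(X)$ is the set of all non-empty compact subsets of $X$; $\operatorname{cl}$ is the closure in $\mathcal{V}_{w,\infty}$. The Hausdorff distance between subsets $X_1,X_2$ of a metric space $(M,d)$ is $$d_{\mathrm H}(X_1,X_2) := \max\Big\{\sup_{x\in X_1}\inf_{y\in X_2}d(x,y),\ \sup_{y\in X_2}\inf_{x\in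 X_1}d(x,y)\Big\}$$ (a metric on $\mathfrak{C}(M)$, a pseudometric on $\mathfrak{P}(M)$); here the metric on $\mathcal{V}_{w,\infty}$ is the one induced by $\|\cdot\|_{w,\infty}$. $\operatorname{Cone}(\mathfrak{P}(M))$ is the set of all cones in $M$, a cone being a set of the form $\{\lambda x:\lambda>0,\ x\in X\}$. The truncated Hausdorff distance between cones is $d_{\mathrm{tH}}(X_1,X_2) := d_{\mathrm H}(S(0,1)\cap X_1, S(0,1)\cap X_2)$. Here $S(0,1)$ is the unit sphere and $B(0,r)$ the open ball of radius $r$ around $0$, both with respect to the $L^2(Y,\rho)$-norm $\|\cdot\|$. $A+B$ and $A\cdot B$ are the sets of all sums, respectively pointwise products, of an element of $A$ and an element of $B$. $A\perp B$ means that every $a\in A$ is $L^2(Y,\rho)$-orthogonal to every $b\in B$. $A$ and $B$ are stochastically independent if every $a\in A$ and every $b\in B$ are independent random variables on $(Y,\rho)$. The tensor product $A\otimes B$ refers to linear spaces $A$, $B$ of functions of separate, independent variables (a product domain with product probability measure): it is the linear span of the products $(a\otimes b)(y) = a(y)b(y)$, $a\in A$, $b\in B$, so that products of elements of orthonormal bases of $A$ and $B$ form an orthonormal basis of $A\otimes B$.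
   Formalization: Functions lie in a linear space where point evaluations are bounded and the ess-sup bound holds off one common null set; V_{w²,∞} means finite weighted norm, without requiring L^∞; items 4 and 5 are restricted to sets A with K_A finite everywhere and in V_{w²,∞}. *)

theory Defs
  imports "HOL-Probability.Probability" "HOL-Library.Function_Algebras" "HOL-Library.Set_Algebras"
begin

(* Pointwise vector space structure on real-valued functions. Sums and products of functions
   are those of Function_Algebras; A + B and A * B for sets are those of Set_Algebras. *)

instantiation "fun" :: (type, real_vector) real_vector
begin

definition scaleR_fun :: "real \<Rightarrow> ('a \<Rightarrow> 'b) \<Rightarrow> 'a \<Rightarrow> 'b" where
  "scaleR_fun c f = (\<lambda>y. c *\<^sub>R f y)"

instance
  by standard (simp_all add: scaleR_fun_def fun_eq_iff scaleR_add_right scaleR_add_left)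

end

definition weight :: "'a measure \<Rightarrow> ('a \<Rightarrow> real) \<Rightarrow> bool" where
  "weight M w \<longleftrightarrow> w \<in> borel_measurable M \<and> (AE y in M. 0 < w y) \<and>
     (\<integral>\<^sup>+ y. ennreal (inverse (w y)) \<partial>M) = 1"

definition weighted_norm :: "'a measure \<Rightarrow> ('a \<Rightarrow> real) \<Rightarrow> ('a \<Rightarrow> real) \<Rightarrow> ennreal" where
  "weighted_norm M w v = esssup M (\<lambda>y. ennreal (sqrt (w y) * \<bar>v y\<bar>))"

definition weighted_dist ::
    "'a measure \<Rightarrow> ('a \<Rightarrow> real) \<Rightarrow> ('a \<Rightarrow> real) \<Rightarrow> ('a \<Rightarrow> real) \<Rightarrow> ennreal" where
  "weighted_dist M w u v = weighted_norm M w (u - v)"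

(* Essential boundedness of v itself is deliberately not required. In the role of the domain this
   is more general, because everything below is stated for an arbitrary linear subspace V of
   weighted_space M w, which may consist of essentially bounded functions. In the role of the
   codomain (weight w^2) it cannot be required: if 1/w is unbounded, the variation function of a
   compact set of essentially bounded functions, not containing 0, may be unbounded. If 1/w is
   essentially bounded, the requirement is automatic. *)
definition weighted_space :: "'a measure \<Rightarrow> ('a \<Rightarrow> real) \<Rightarrow> ('a \<Rightarrow> real) set" where
  "weighted_space M w = {v \<in> borel_measurable M. weighted_norm M w v < \<top>}"

(* The space of functions with point evaluations. Its elements are honest functions, representing
   elements of the weighted L-infinity space. For honest functions the values on null sets are
   not controlled by the essential supremum (for atomless M, {1} and {1 + indicator {s} | s} have
   Hausdorff distance 0 but variation functions 1 and 4), so "having point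
   evaluations" means: evaluation at each y is a bounded functional on V, and for almost every y
   the bound sqrt (w y) * |v y| <= weighted_norm M w v holds simultaneously for all v in V, i.e.
   the exceptional null set in the essential supremum does not depend on v.
   Examples: continuous functions when w is continuous and positive and M has full support; all
   of weighted_space M w when M is discrete with positive point masses and w > 0; and, on every
   complete probability space, a linear system of representatives of the whole weighted space
   (by a linear lifting of L-infinity). *)
definition evaluation_space ::
    "'a measure \<Rightarrow> ('a \<Rightarrow> real) \<Rightarrow> ('a \<Rightarrow> real) set \<Rightarrow> bool" where
  "evaluation_space M w V \<longleftrightarrow>
     subspace V \<and> V \<subseteq> weighted_space M w \<and>
     (\<forall>y\<in>space M. \<exists>C::real. \<forall>v\<in>V. ennreal \<bar>v y\<bar> \<le> ennreal C * weighted_norm M w v) \<and>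
     (AE y in M. \<forall>v\<in>V. ennreal (sqrt (w y) * \<bar>v y\<bar>) \<le> weighted_norm M w v)"

definition L2norm :: "'a measure \<Rightarrow> ('a \<Rightarrow> real) \<Rightarrow> real" where
  "L2norm M v = sqrt (\<integral>y. (v y)\<^sup>2 \<partial>M)"

(* "u = 0" is equality in L2, i.e. almost everywhere; on a space with point evaluations this is
   the same as u y = 0 for all y in space M. *)
definition nonzero :: "'a measure \<Rightarrow> ('a \<Rightarrow> real) set" where
  "nonzero M = {u. \<not> (AE y in M. u y = 0)}"

definition normalised :: "'a measure \<Rightarrow> ('a \<Rightarrow> real) set \<Rightarrow> ('a \<Rightarrow> real) set" where
  "normalised M A = (\<lambda>u y. u y / L2norm M u) ` (A \<inter> nonzero M)"

(* Values in [0, \<infinity>]; the supremum of the empty set is 0. *)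
definition variation :: "'a measure \<Rightarrow> ('a \<Rightarrow> real) set \<Rightarrow> 'a \<Rightarrow> ennreal" where
  "variation M A y = (SUP a\<in>normalised M A. ennreal (\<bar>a y\<bar>\<^sup>2))"

definition real_variation :: "'a measure \<Rightarrow> ('a \<Rightarrow> real) set \<Rightarrow> 'a \<Rightarrow> real" where
  "real_variation M A = (\<lambda>y. enn2real (variation M A y))"

(* The variation function of A is an element of the space with weight w^2. This holds for compact
   sets not containing 0, but not for arbitrary sets: for linear A the variation function may be
   infinite everywhere. *)
definition admissible :: "'a measure \<Rightarrow> ('a \<Rightarrow> real) \<Rightarrow> ('a \<Rightarrow> real) set \<Rightarrow> bool" where
  "admissible M w A \<longleftrightarrow> (\<forall>y\<in>space M. variation M A y < \<top>) \<and>
     real_variation M A \<in> weighted_space M (\<lambda>y. (w y)\<^sup>2)"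

(* The topology on S of an extended-valued pseudometric d. *)
definition pm_topology :: "'b set \<Rightarrow> ('b \<Rightarrow> 'b \<Rightarrow> ennreal) \<Rightarrow> 'b topology" where
  "pm_topology S d =
     topology_generated_by {{y \<in> S. d x y < ennreal e} | x e. x \<in> S \<and> 0 < e}"

definition hausdorff_dist :: "('b \<Rightarrow> 'b \<Rightarrow> ennreal) \<Rightarrow> 'b set \<Rightarrow> 'b set \<Rightarrow> ennreal" where
  "hausdorff_dist d X1 X2 =
     max (SUP x\<in>X1. INF y\<in>X2. d x y) (SUP y\<in>X2. INF x\<in>X1. d x y)"

definition truncated_hausdorff_dist ::
    "'a measure \<Rightarrow> (('a \<Rightarrow> real) \<Rightarrow> ('a \<Rightarrow> real) \<Rightarrow> ennreal) \<Rightarrow>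
     ('a \<Rightarrow> real) set \<Rightarrow> ('a \<Rightarrow> real) set \<Rightarrow> ennreal" where
  "truncated_hausdorff_dist M d X1 X2 =
     hausdorff_dist d ({v. L2norm M v = 1} \<inter> X1) ({v. L2norm M v = 1} \<inter> X2)"

(* Unlike the library's cone, scaling by 0 is excluded. *)
definition open_cone :: "('a \<Rightarrow> real) set \<Rightarrow> bool" where
  "open_cone A \<longleftrightarrow> (\<exists>X. A = {c *\<^sub>R x | c x. 0 < c \<and> x \<in> X})"

definition L2_orthogonal :: "'a measure \<Rightarrow> ('a \<Rightarrow> real) set \<Rightarrow> ('a \<Rightarrow> real) set \<Rightarrow> bool" where
  "L2_orthogonal M A B \<longleftrightarrow> (\<forall>a\<in>A. \<forall>b\<in>B. (\<integral>y. a y * b y \<partial>M) = 0)"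

definition stoch_independent ::
    "'a measure \<Rightarrow> ('a \<Rightarrow> real) set \<Rightarrow> ('a \<Rightarrow> real) set \<Rightarrow> bool" where
  "stoch_independent M A B \<longleftrightarrow> (\<forall>a\<in>A. \<forall>b\<in>B. prob_space.indep_var M borel a borel b)"

definition tensor :: "('a \<Rightarrow> real) set \<Rightarrow> ('b \<Rightarrow> real) set \<Rightarrow> ('a \<times> 'b \<Rightarrow> real) set" where
  "tensor E F = span {\<lambda>(x, y). e x * f y | e f. e \<in> E \<and> f \<in> F}"

end

(*
  Points 2 to 5 rest on two bounds: the L2 norm is dominated by the weighted supremum norm, because
  1 / w is a probability density, and for almost every y the weighted norm controls
  sqrt (w y) * |v y| for all v in V at once. Hence the normalised values
  q u = sqrt (w y) * |u y| / ||u|| of two elements at weighted distance < eta and with norms >= r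
  differ by at most eta * (1 + S) / r, where S^2 bounds w * K_A. Squaring and taking suprema gives
  continuity in the norm with weight w^2. A compact set away from 0 has norms bounded below, and
  so has every set close to it; a cone is determined by its intersection with the unit sphere.

  For tensor products, the slice u (x, _) of u lies in F, so u (x, y)^2 <= K_F y * ||u (x, _)||^2.
  Pairing all slices with u (x, _) gives an element of E, and the Cauchy-Schwarz inequality turns
  its value at x into ||u (x, _)||^2 <= K_E x * ||u||^2.
*)
theory Submission
  imports Defs
begin

subsection \<open>Square integrable functions\<close>

text \<open>The variation at a point is a supremum over a possibly uncountable set of honest
  functions, and three difficulties follow. Estimates that hold a.e. for each function cannot be
  passed to the supremum, so they always enter with one null set for all of \<open>V\<close>;
  measurability of the supremum is obtained, for compact sets, from a countable dense subset, and is
  otherwise part of \<open>admissible\<close>. Functions that vanish a.e. are dropped by the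
  normalisation, yet their point values still enter sums and tensors: on \<open>V\<close> they
  vanish at every point because evaluation is bounded by the weighted norm, while in the tensor
  factors, which are known only to lie in L2, finiteness of the variation forces the same
  conclusion. Finally the variation may be infinite, so the product rules live in [0, \<infinity>]
  with 0 * \<infinity> = 0, and the case of a zero factor against an infinite one needs its own
  argument.\<close>

definition square_integrable :: "'a measure \<Rightarrow> ('a \<Rightarrow> real) set" where
  "square_integrable M = {f \<in> borel_measurable M. integrable M (\<lambda>x. (f x)\<^sup>2)}"

lemma square_integrable_integrable: "f \<in> square_integrable M \<Longrightarrow> integrable M (\<lambda>x. (f x)\<^sup>2)"
  by (simp add: square_integrable_def)

lemma square_integrable_mult:
  assumes "f \<in> square_integrable M" "g \<in> square_integrable M"
  shows "integrable M (\<lambda>x. f x * g x)"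
proof (rule Bochner_Integration.integrable_bound)
  show "integrable M (\<lambda>x. (f x)\<^sup>2 + (g x)\<^sup>2)"
    using assms by (simp add: square_integrable_def)
  show "(\<lambda>x. f x * g x) \<in> borel_measurable M"
    using assms by (intro borel_measurable_times) (auto simp: square_integrable_def)
  have "\<bar>s * t\<bar> \<le> s\<^sup>2 + t\<^sup>2" for s t :: real
    using sum_squares_bound[of "\<bar>s\<bar>" "\<bar>t\<bar>"] abs_ge_zero[of "s * t"]
    unfolding abs_mult power2_abs by linarith
  then show "AE x in M. norm (f x * g x) \<le> norm ((f x)\<^sup>2 + (g x)\<^sup>2)"
    by simp
qed

lemma subspace_square_integrable: "subspace (square_integrable M)"
proof (rule subspaceI)
  show "0 \<in> square_integrable M"
    by (simp add: square_integrable_def zero_fun_def)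
next
  fix f g assume fg: "f \<in> square_integrable M" "g \<in> square_integrable M"
  have "integrable M (\<lambda>x. (f x)\<^sup>2 + (g x)\<^sup>2 + 2 * (f x * g x))"
    using fg square_integrable_mult[OF fg] by (simp add: square_integrable_def)
  moreover have "(\<lambda>x. f x + g x) \<in> borel_measurable M"
    using fg by (intro borel_measurable_add) (auto simp: square_integrable_def)
  ultimately show "f + g \<in> square_integrable M"
    by (simp add: square_integrable_def plus_fun_def power2_sum mult.assoc)
next
  fix f :: "'a \<Rightarrow> real" and c :: real assume "f \<in> square_integrable M"
  then show "c *\<^sub>R f \<in> square_integrable M"
    by (auto simp: square_integrable_def scaleR_fun_def power_mult_distrib intro: borel_measurable_times)
qed

section \<open>The L2 norm\<close>

lemma L2norm_nonneg: "0 \<le> L2norm M f"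
  by (simp add: L2norm_def)

lemma L2norm_sq: "(L2norm M f)\<^sup>2 = (\<integral>x. (f x)\<^sup>2 \<partial>M)"
  by (simp add: L2norm_def)

lemma L2norm_scaleR: "L2norm M (c *\<^sub>R f) = \<bar>c\<bar> * L2norm M f"
  by (simp add: L2norm_def scaleR_fun_def power_mult_distrib real_sqrt_mult)

lemma L2norm_uminus: "L2norm M (- f) = L2norm M f"
  by (simp add: L2norm_def)

lemma L2norm_add_sq:
  assumes "f \<in> square_integrable M" "g \<in> square_integrable M"
  shows "(L2norm M (f + g))\<^sup>2 = (L2norm M f)\<^sup>2 + 2 * (\<integral>x. f x * g x \<partial>M) + (L2norm M g)\<^sup>2"
proof -
  have "(L2norm M (f + g))\<^sup>2 = (\<integral>x. (f x)\<^sup>2 + 2 * (f x * g x) + (g x)\<^sup>2 \<partial>M)"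
    unfolding L2norm_sq by (simp add: power2_sum algebra_simps)
  also have "\<dots> = (\<integral>x. (f x)\<^sup>2 \<partial>M) + 2 * (\<integral>x. f x * g x \<partial>M) + (\<integral>x. (g x)\<^sup>2 \<partial>M)"
    using assms square_integrable_mult[OF assms] by (simp add: square_integrable_def)
  finally show ?thesis by (simp add: L2norm_sq)
qed

text \<open>The quadratic polynomial t \<mapsto>
  \<open>(L2norm M (f + t *\<^sub>R g))\<^sup>2\<close> is nonnegative, which bounds its
  discriminant.\<close>

lemma L2_Cauchy_Schwarz:
  assumes "f \<in> square_integrable M" "g \<in> square_integrable M"
  shows "\<bar>\<integral>x. f x * g x \<partial>M\<bar> \<le> L2norm M f * L2norm M g"
proof -
  define F P G where "F = (L2norm M f)\<^sup>2" and "P = (\<integral>x. f x * g x \<partial>M)" and "G = (L2norm M g)\<^sup>2"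
  have quad: "0 \<le> F + 2 * t * P + t\<^sup>2 * G" for t
  proof -
    have "t *\<^sub>R g \<in> square_integrable M"
      using assms(2) subspace_square_integrable subspace_scale by blast
    moreover have "(\<integral>x. f x * (t *\<^sub>R g) x \<partial>M) = t * P"
      by (simp add: P_def scaleR_fun_def mult.left_commute)
    ultimately have "(L2norm M (f + t *\<^sub>R g))\<^sup>2 = F + 2 * t * P + t\<^sup>2 * G"
      using L2norm_add_sq[OF assms(1)]
      by (simp add: F_def G_def L2norm_scaleR power_mult_distrib)
    then show ?thesis using zero_le_power2[of "L2norm M (f + t *\<^sub>R g)"] by linarith
  qed
  have "P\<^sup>2 \<le> F * G"
  proof (cases "G = 0")
    case True
    have "P = 0"
    proof (rule ccontr)
      assume "P \<noteq> 0"
      \<comment> \<open>With \<open>G = 0\<close> the polynomial is affine in t; this t gives it the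
        value -1.\<close>
      with quad[of "- (F + 1) / (2 * P)"] True \<open>P \<noteq> 0\<close> show False
        by (simp add: field_simps)
    qed
    then show ?thesis by (simp add: True)
  next
    case False
    then have "0 < G" by (simp add: G_def)
    \<comment> \<open>The minimiser of the polynomial, where its value is
      \<open>F - P\<^sup>2 / G\<close>.\<close>
    with quad[of "- P / G"] show ?thesis
      by (simp add: field_simps power2_eq_square)
  qed
  then have "P\<^sup>2 \<le> (L2norm M f * L2norm M g)\<^sup>2"
    by (simp add: F_def G_def power_mult_distrib)
  then show ?thesis
    unfolding P_def by (simp add: L2norm_nonneg abs_le_square_iff[symmetric])
qed

lemma L2norm_triangle:
  assumes "f \<in> square_integrable M" "g \<in> square_integrable M"
  shows "L2norm M (f + g) \<le> L2norm M f + L2norm M g"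
proof (rule power2_le_imp_le)
  show "(L2norm M (f + g))\<^sup>2 \<le> (L2norm M f + L2norm M g)\<^sup>2"
    using L2norm_add_sq[OF assms] L2_Cauchy_Schwarz[OF assms] by (simp add: power2_sum)
qed (simp add: L2norm_nonneg)

lemma L2norm_diff:
  assumes "f \<in> square_integrable M" "g \<in> square_integrable M"
  shows "\<bar>L2norm M f - L2norm M g\<bar> \<le> L2norm M (f - g)"
proof -
  note sub = subspace_diff[OF subspace_square_integrable]
  have "L2norm M f \<le> L2norm M (f - g) + L2norm M g"
    using L2norm_triangle[OF sub[OF assms] assms(2)] by simp
  moreover have "L2norm M g \<le> L2norm M (g - f) + L2norm M f"
    using L2norm_triangle[OF sub[OF assms(2,1)] assms(1)] by simp
  moreover have "L2norm M (g - f) = L2norm M (f - g)"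
    using L2norm_uminus[of M "f - g"] by simp
  ultimately show ?thesis by simp
qed

lemma L2norm_eq_0_iff:
  assumes "f \<in> square_integrable M"
  shows "L2norm M f = 0 \<longleftrightarrow> (AE x in M. f x = 0)"
  using integral_nonneg_eq_0_iff_AE[OF square_integrable_integrable[OF assms]]
  by (simp add: L2norm_def)

lemma nonzero_iff:
  assumes "f \<in> square_integrable M"
  shows "f \<in> nonzero M \<longleftrightarrow> 0 < L2norm M f"
  using L2norm_eq_0_iff[OF assms] L2norm_nonneg[of M f] by (auto simp: nonzero_def)

subsection \<open>The variation function\<close>

lemma variation_eq_SUP:
  "variation M A y = (SUP u\<in>A \<inter> nonzero M. ennreal ((u y / L2norm M u)\<^sup>2))"
  by (simp add: variation_def normalised_def image_comp o_def)

lemma variation_upper: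
  "u \<in> A \<Longrightarrow> u \<in> nonzero M \<Longrightarrow> ennreal ((u y / L2norm M u)\<^sup>2) \<le> variation M A y"
  unfolding variation_eq_SUP by (rule SUP_upper) simp

lemma variation_least:
  "(\<And>u. u \<in> A \<Longrightarrow> u \<in> nonzero M \<Longrightarrow> ennreal ((u y / L2norm M u)\<^sup>2) \<le> c) \<Longrightarrow> variation M A y \<le> c"
  unfolding variation_eq_SUP by (rule SUP_least) simp

lemma variation_mono: "A \<subseteq> B \<Longrightarrow> variation M A y \<le> variation M B y"
  by (rule variation_least) (auto intro: variation_upper)

lemma variation_Union: "variation M (\<Union>\<A>) y = (SUP A\<in>\<A>. variation M A y)"
proof (rule antisym)
  show "variation M (\<Union>\<A>) y \<le> (SUP A\<in>\<A>. variation M A y)"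
    by (rule variation_least) (auto intro: SUP_upper2 variation_upper)
  show "(SUP A\<in>\<A>. variation M A y) \<le> variation M (\<Union>\<A>) y"
    by (auto intro!: SUP_least variation_mono)
qed

text \<open>Multiplication by a constant commutes with suprema in [0, \<infinity>], including empty
  suprema, because 0 * \<infinity> = 0. Two measures are allowed so that both the independent
  products on one space and the tensor products can use it.\<close>

lemma variation_mult:
  fixes A :: "('a \<Rightarrow> real) set" and B :: "('b \<Rightarrow> real) set"
  shows "variation M A x * variation N B y =
    (SUP a\<in>A \<inter> nonzero M. SUP b\<in>B \<inter> nonzero N.
      ennreal ((a x * b y / (L2norm M a * L2norm N b))\<^sup>2))"
  unfolding variation_eq_SUP
  by (subst SUP_mult_right_ennreal, subst SUP_mult_left_ennreal, intro SUP_cong refl) (simp add: ennreal_mult[symmetric] power_mult_distrib power_divide)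

text \<open>Finiteness matters here: \<open>enn2real\<close> sends an infinite supremum to
  0.\<close>

lemma real_variation_upper:
  assumes "variation M A y < \<top>" "u \<in> A" "u \<in> nonzero M"
  shows "(u y / L2norm M u)\<^sup>2 \<le> real_variation M A y"
  using variation_upper[OF assms(2,3), of y] assms(1)
  by (cases "variation M A y") (auto simp: real_variation_def)

lemma real_variation_least:
  assumes "\<And>u. u \<in> A \<Longrightarrow> u \<in> nonzero M \<Longrightarrow> (u y / L2norm M u)\<^sup>2 \<le> c" "0 \<le> c"
  shows "real_variation M A y \<le> c"
  unfolding real_variation_def
  by (rule enn2real_leI[OF assms(2)]) (auto intro!: variation_least ennreal_leI assms(1))

subsection \<open>Topologies of extended pseudometrics\<close>

lemma openin_pm_ball:
  "x \<in> S \<Longrightarrow> 0 < e \<Longrightarrow> openin (pm_topology S d) {y \<in> S. d x y < ennreal e}"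
  unfolding pm_topology_def by (rule topology_generated_by_Basis) blast

lemma topspace_pm_topology:
  assumes "\<And>x. x \<in> S \<Longrightarrow> d x x = 0"
  shows "topspace (pm_topology S d) = S"
proof
  show "topspace (pm_topology S d) \<subseteq> S"
    unfolding pm_topology_def topology_generated_by_topspace by auto
  show "S \<subseteq> topspace (pm_topology S d)"
  proof
    fix x assume "x \<in> S"
    then show "x \<in> topspace (pm_topology S d)"
      using openin_subset[OF openin_pm_ball[of x S 1 d]] assms[of x] by auto
  qed
qed

text \<open>Balls around points of \<open>S\<close> are open by construction, so reflexivity of
  \<open>d\<close> suffices on the domain side and no triangle inequality for Hausdorff distances
  has to be proved. In the target, the triangle inequality fits a ball around \<open>f x\<close>
  into any generating ball that contains \<open>f x\<close>.\<close>

lemma continuous_map_pm_topology: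
  assumes S: "\<And>x. x \<in> S \<Longrightarrow> d x x = 0"
    and f: "\<And>x. x \<in> S \<Longrightarrow> f x \<in> T"
    and T: "\<And>x. x \<in> T \<Longrightarrow> d' x x = 0"
      "\<And>x y z. x \<in> T \<Longrightarrow> y \<in> T \<Longrightarrow> z \<in> T \<Longrightarrow> d' x z \<le> d' x y + d' y z"
    and cont: "\<And>x e. x \<in> S \<Longrightarrow> 0 < e \<Longrightarrow>
      \<exists>\<delta>>0. \<forall>x'\<in>S. d x x' < ennreal \<delta> \<longrightarrow> d' (f x) (f x') < ennreal e"
  shows "continuous_map (pm_topology S d) (pm_topology T d') f"
  unfolding pm_topology_def[of T]
proof (rule continuous_on_generated_topo)
  show "f ` topspace (pm_topology S d) \<subseteq> \<Union> {{y \<in> T. d' x y < ennreal e} | x e. x \<in> T \<and> 0 < e}"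
  proof
    fix t assume "t \<in> f ` topspace (pm_topology S d)"
    then have "t \<in> T" using f by (auto simp: topspace_pm_topology[of S d, OF S])
    then have "t \<in> {y \<in> T. d' t y < ennreal 1}" using T(1) by simp
    with \<open>t \<in> T\<close> show "t \<in> \<Union> {{y \<in> T. d' x y < ennreal e} | x e. x \<in> T \<and> 0 < e}"
      using zero_less_one by blast
  qed
next
  fix U assume "U \<in> {{y \<in> T. d' x y < ennreal e} | x e. x \<in> T \<and> 0 < e}"
  then obtain t e where U: "U = {y \<in> T. d' t y < ennreal e}" and t: "t \<in> T" "0 < e" by auto
  show "openin (pm_topology S d) (f -` U \<inter> topspace (pm_topology S d))"
  proof (subst openin_subopen, intro ballI)
    fix x assume "x \<in> f -` U \<inter> topspace (pm_topology S d)"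
    then have x: "x \<in> S" "d' t (f x) < ennreal e"
      by (auto simp: topspace_pm_topology[of S d, OF S] U)
    obtain c where c: "d' t (f x) = ennreal c" "0 \<le> c" "c < e"
      using x(2) by (cases "d' t (f x)") (auto simp: ennreal_less_iff)
    obtain \<delta> where \<delta>: "\<delta> > 0" "\<And>x'. x' \<in> S \<Longrightarrow> d x x' < ennreal \<delta> \<Longrightarrow> d' (f x) (f x') < ennreal (e - c)"
      using cont[OF x(1), of "e - c"] c(3) by auto
    have "d' t (f x') < ennreal e" if "x' \<in> S" "d x x' < ennreal \<delta>" for x'
    proof -
      have "d' t (f x') \<le> d' t (f x) + d' (f x) (f x')"
        using T(2)[of t "f x" "f x'"] t f that x by simp
      also have "\<dots> < ennreal c + ennreal (e - c)"
        unfolding c(1) using \<delta>(2)[OF that] by (simp add: ennreal_add_left_cancel_less)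
      finally show ?thesis using c by (simp add: ennreal_plus[symmetric] del: ennreal_plus)
    qed
    then show "\<exists>W. openin (pm_topology S d) W \<and> x \<in> W \<and> W \<subseteq> f -` U \<inter> topspace (pm_topology S d)"
      using openin_pm_ball[OF x(1) \<delta>(1), of d] x(1) S[of x] f \<delta>(1)
      by (intro exI[of _ "{y \<in> S. d x y < ennreal \<delta>}"])
         (auto simp: U topspace_pm_topology[of S d, OF S])
  qed
qed

text \<open>The radius may depend on the centre: the lower bound on L2 norms uses half the norm of
  the centre as radius.\<close>

lemma compactin_pm_topology_finite_cover:
  assumes S: "\<And>x. x \<in> S \<Longrightarrow> d x x = 0"
    and K: "compactin (pm_topology S d) K"
    and e: "\<And>x. x \<in> K \<Longrightarrow> 0 < e x"
  obtains T where "finite T" "T \<subseteq> K" "\<And>x. x \<in> K \<Longrightarrow> \<exists>t\<in>T. d t x < ennreal (e t)"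
proof -
  define ball where "ball x = {y \<in> S. d x y < ennreal (e x)}" for x
  have KS: "K \<subseteq> S"
    using K by (simp add: compactin_def topspace_pm_topology[of S d, OF S])
  have "\<exists>\<F>. finite \<F> \<and> \<F> \<subseteq> ball ` K \<and> K \<subseteq> \<Union>\<F>"
  proof (rule compactinD[OF K])
    show "openin (pm_topology S d) U" if "U \<in> ball ` K" for U
      using that KS e openin_pm_ball[of _ S _ d] unfolding ball_def by auto
    show "K \<subseteq> \<Union> (ball ` K)"
      using KS e S unfolding ball_def by force
  qed
  then obtain \<F> where "finite \<F>" "\<F> \<subseteq> ball ` K" "K \<subseteq> \<Union>\<F>" by auto
  moreover obtain T where "T \<subseteq> K" "finite T" "\<F> = ball ` T"
    using finite_subset_image[OF calculation(1,2)] by metis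
  ultimately show thesis
    by (intro that[of T]) (auto simp: ball_def subset_eq)
qed

section \<open>Hausdorff distance\<close>

lemma hausdorff_dist_lessD1:
  assumes "hausdorff_dist d X Y < e" "x \<in> X"
  shows "\<exists>y\<in>Y. d x y < e"
proof -
  have "(INF y\<in>Y. d x y) \<le> hausdorff_dist d X Y"
    unfolding hausdorff_dist_def using assms(2) by (intro max.coboundedI1 SUP_upper)
  with assms(1) show ?thesis by (simp add: INF_less_iff[symmetric])
qed

lemma hausdorff_dist_lessD2:
  assumes "hausdorff_dist d X Y < e" "y \<in> Y"
  shows "\<exists>x\<in>X. d x y < e"
proof -
  have "(INF x\<in>X. d x y) \<le> hausdorff_dist d X Y"
    unfolding hausdorff_dist_def using assms(2) by (intro max.coboundedI2 SUP_upper)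
  with assms(1) show ?thesis by (simp add: INF_less_iff[symmetric])
qed

lemma hausdorff_dist_refl:
  assumes "\<And>x. x \<in> X \<Longrightarrow> d x x = 0"
  shows "hausdorff_dist d X X = 0"
proof -
  have "(SUP x\<in>X. INF y\<in>X. d x y) \<le> 0"
    by (rule SUP_least) (metis INF_lower assms)
  moreover have "(SUP y\<in>X. INF x\<in>X. d x y) \<le> 0"
    by (rule SUP_least) (metis INF_lower assms)
  ultimately show ?thesis by (simp add: hausdorff_dist_def)
qed

subsection \<open>The weighted supremum norm\<close>

lemma weighted_norm_AE: "AE y in M. ennreal (sqrt (w y) * \<bar>v y\<bar>) \<le> weighted_norm M w v"
  unfolding weighted_norm_def by (rule esssup_AE)

lemma weighted_norm_leI:
  assumes "w \<in> borel_measurable M" "v \<in> borel_measurable M"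
    and "AE y in M. ennreal (sqrt (w y) * \<bar>v y\<bar>) \<le> c"
  shows "weighted_norm M w v \<le> c"
  unfolding weighted_norm_def
proof (rule esssup_I)
  have [measurable]: "w \<in> borel_measurable M" "v \<in> borel_measurable M" by fact+
  show "(\<lambda>y. ennreal (sqrt (w y) * \<bar>v y\<bar>)) \<in> borel_measurable M" by measurable
qed fact

lemma weighted_norm_triangle:
  assumes "w \<in> borel_measurable M" "u \<in> borel_measurable M" "v \<in> borel_measurable M"
  shows "weighted_norm M w (u + v) \<le> weighted_norm M w u + weighted_norm M w v"
proof (rule weighted_norm_leI)
  have [measurable]: "u \<in> borel_measurable M" "v \<in> borel_measurable M" by fact+
  show "u + v \<in> borel_measurable M" unfolding plus_fun_def by measurable
  show "AE y in M. ennreal (sqrt (w y) * \<bar>(u + v) y\<bar>) \<le> weighted_norm M w u + weighted_norm M w v"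
    using weighted_norm_AE[where w = w and v = u] weighted_norm_AE[where w = w and v = v]
  proof eventually_elim
    fix y
    assume le: "ennreal (sqrt (w y) * \<bar>u y\<bar>) \<le> weighted_norm M w u"
      "ennreal (sqrt (w y) * \<bar>v y\<bar>) \<le> weighted_norm M w v"
    have "ennreal (sqrt (w y) * \<bar>(u + v) y\<bar>)
        \<le> ennreal (sqrt (w y) * \<bar>u y\<bar>) + ennreal (sqrt (w y) * \<bar>v y\<bar>)"
    proof (cases "0 \<le> sqrt (w y)")
      case True
      then have "sqrt (w y) * \<bar>u y + v y\<bar> \<le> sqrt (w y) * (\<bar>u y\<bar> + \<bar>v y\<bar>)"
        by (intro mult_left_mono abs_triangle_ineq)
      with True show ?thesis
        by (simp add: ennreal_plus[symmetric] distrib_left ennreal_leI del: ennreal_plus)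
    next
      \<comment> \<open>The weight is positive only a.e.; where \<open>w y < 0\<close>,
        \<open>sqrt (w y)\<close> is negative and \<open>ennreal\<close> truncates to 0.\<close>
      case False
      then have "ennreal (sqrt (w y) * \<bar>(u + v) y\<bar>) = 0"
        by (intro ennreal_neg mult_nonpos_nonneg) auto
      then show ?thesis by simp
    qed
    with add_mono[OF le] show "ennreal (sqrt (w y) * \<bar>(u + v) y\<bar>)
        \<le> weighted_norm M w u + weighted_norm M w v" by order
  qed
qed fact

lemma weighted_norm_null:
  assumes "w \<in> borel_measurable M" "v \<in> borel_measurable M" "AE y in M. v y = 0"
  shows "weighted_norm M w v = 0"
proof -
  have "weighted_norm M w v \<le> 0"
    using assms(3) by (intro weighted_norm_leI assms(1,2)) (auto elim!: eventually_mono)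
  then show ?thesis by simp
qed

lemma weighted_dist_refl: "w \<in> borel_measurable M \<Longrightarrow> weighted_dist M w u u = 0"
  unfolding weighted_dist_def by (rule weighted_norm_null) (auto simp: zero_fun_def)

lemma weighted_dist_commute: "weighted_dist M w u v = weighted_dist M w v u"
  by (simp add: weighted_dist_def weighted_norm_def abs_minus_commute)

lemma weighted_dist_triangle:
  assumes "w \<in> borel_measurable M"
    and "t \<in> borel_measurable M" "u \<in> borel_measurable M" "v \<in> borel_measurable M"
  shows "weighted_dist M w t v \<le> weighted_dist M w t u + weighted_dist M w u v"
proof -
  have [measurable]: "t \<in> borel_measurable M" "u \<in> borel_measurable M" "v \<in> borel_measurable M"
    by fact+
  have "t - u \<in> borel_measurable M" "u - v \<in> borel_measurable M"
    unfolding fun_diff_def by measurable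
  from weighted_norm_triangle[OF assms(1) this] show ?thesis
    by (simp add: weighted_dist_def)
qed

lemma weighted_space_measurable: "v \<in> weighted_space M w \<Longrightarrow> v \<in> borel_measurable M"
  by (simp add: weighted_space_def)

locale weighted_prob_space = prob_space M for M :: "'a measure" +
  fixes w :: "'a \<Rightarrow> real"
  assumes weight: "weight M w"
begin

lemma w_measurable [measurable]: "w \<in> borel_measurable M"
  and w_pos: "AE y in M. 0 < w y"
  using weight by (auto simp: weight_def)

lemma
  shows integrable_inverse_w: "integrable M (\<lambda>y. inverse (w y))"
    and integral_inverse_w: "(\<integral>y. inverse (w y) \<partial>M) = 1"
proof -
  have nonneg: "AE y in M. 0 \<le> inverse (w y)"
    using w_pos by eventually_elim simp
  show "integrable M (\<lambda>y. inverse (w y))"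
    using nonneg weight by (intro integrableI_nonneg) (auto simp: weight_def)
  show "(\<integral>y. inverse (w y) \<partial>M) = 1"
    using nonneg weight by (subst integral_eq_nn_integral) (auto simp: weight_def)
qed

lemma
  assumes "v \<in> weighted_space M w"
  shows weighted_space_square_integrable: "v \<in> square_integrable M"
    and L2norm_le_weighted_norm: "ennreal (L2norm M v) \<le> weighted_norm M w v"
proof -
  obtain n where n: "weighted_norm M w v = ennreal n" "0 \<le> n"
    using assms by (cases "weighted_norm M w v") (auto simp: weighted_space_def)
  have [measurable]: "v \<in> borel_measurable M"
    using assms by (rule weighted_space_measurable)
  \<comment> \<open>The majorant is integrable, and its integral is \<open>n\<^sup>2\<close> since
    \<open>inverse (w y)\<close> integrates to 1; this settles both claims.\<close>
  have bound: "AE y in M. (v y)\<^sup>2 \<le> n\<^sup>2 * inverse (w y)"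
    using w_pos weighted_norm_AE[where w = w and v = v]
  proof eventually_elim
    fix y assume "0 < w y" "ennreal (sqrt (w y) * \<bar>v y\<bar>) \<le> weighted_norm M w v"
    then have "(sqrt (w y) * \<bar>v y\<bar>)\<^sup>2 \<le> n\<^sup>2"
      using n by (intro power_mono) auto
    with \<open>0 < w y\<close> show "(v y)\<^sup>2 \<le> n\<^sup>2 * inverse (w y)"
      by (simp add: power_mult_distrib field_simps)
  qed
  have "integrable M (\<lambda>y. (v y)\<^sup>2)"
  proof (rule Bochner_Integration.integrable_bound)
    show "integrable M (\<lambda>y. n\<^sup>2 * inverse (w y))"
      using integrable_inverse_w by simp
    show "AE y in M. norm ((v y)\<^sup>2) \<le> norm (n\<^sup>2 * inverse (w y))"
      using bound by eventually_elim auto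
  qed measurable
  then show sq: "v \<in> square_integrable M" by (simp add: square_integrable_def)
  have "(L2norm M v)\<^sup>2 \<le> (\<integral>y. n\<^sup>2 * inverse (w y) \<partial>M)"
    unfolding L2norm_sq using integrable_inverse_w bound square_integrable_integrable[OF sq]
    by (intro integral_mono_AE) auto
  also have "\<dots> = n\<^sup>2" by (simp add: integral_inverse_w)
  finally have "L2norm M v \<le> n" using n(2) by (rule power2_le_imp_le)
  then show "ennreal (L2norm M v) \<le> weighted_norm M w v"
    by (simp add: n ennreal_leI)
qed

end

subsection \<open>Spaces with point evaluations\<close>

locale point_evaluation_space = weighted_prob_space +
  fixes V
  assumes evaluation: "evaluation_space M w V"
begin

lemma subspace_V: "subspace V" and V_weighted: "V \<subseteq> weighted_space M w"
  using evaluation by (auto simp: evaluation_space_def)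

lemma V_diff: "u \<in> V \<Longrightarrow> v \<in> V \<Longrightarrow> u - v \<in> V"
  by (rule subspace_diff[OF subspace_V])

lemma V_measurable: "v \<in> V \<Longrightarrow> v \<in> borel_measurable M"
  using V_weighted weighted_space_measurable by blast

lemma V_square_integrable: "v \<in> V \<Longrightarrow> v \<in> square_integrable M"
  using V_weighted weighted_space_square_integrable by blast

lemma V_nonzero_iff: "v \<in> V \<Longrightarrow> v \<in> nonzero M \<longleftrightarrow> 0 < L2norm M v"
  by (simp add: V_square_integrable nonzero_iff)

text \<open>A real-valued form of the evaluation bound: any real \<open>e\<close> above the weighted
  norm may replace it, which keeps later estimates free of extended arithmetic.\<close>

lemma point_bound:
  assumes "y \<in> space M"
  obtains C where "0 \<le> C" "\<And>v e. v \<in> V \<Longrightarrow> 0 \<le> e \<Longrightarrow> weighted_norm M w v \<le> ennreal e \<Longrightarrow> \<bar>v y\<bar> \<le> C * e"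
proof -
  obtain C where C: "\<And>v. v \<in> V \<Longrightarrow> ennreal \<bar>v y\<bar> \<le> ennreal C * weighted_norm M w v"
    using evaluation assms unfolding evaluation_space_def by blast
  \<comment> \<open>The given constant may be negative, in which case \<open>ennreal\<close> reads
    it as 0.\<close>
  define C' where "C' = max 0 C"
  have C': "0 \<le> C'" "C \<le> C'" by (auto simp: C'_def)
  show thesis
  proof (rule that[OF C'(1)])
    fix v e assume v: "v \<in> V" "(0::real) \<le> e" "weighted_norm M w v \<le> ennreal e"
    have "ennreal \<bar>v y\<bar> \<le> ennreal C * weighted_norm M w v" by (rule C[OF v(1)])
    also have "\<dots> \<le> ennreal C' * ennreal e"
      using v(3) C' by (intro mult_mono ennreal_leI) auto
    also have "\<dots> = ennreal (C' * e)" using v(2) C' by (simp add: ennreal_mult)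
    finally show "\<bar>v y\<bar> \<le> C' * e"
      using v(2) C' by (subst (asm) ennreal_le_iff) auto
  qed
qed

lemma AE_point_bound:
  "AE y in M. \<forall>v\<in>V. \<forall>e\<ge>0. weighted_norm M w v \<le> ennreal e \<longrightarrow> sqrt (w y) * \<bar>v y\<bar> \<le> e"
proof -
  have "AE y in M. \<forall>v\<in>V. ennreal (sqrt (w y) * \<bar>v y\<bar>) \<le> weighted_norm M w v"
    using evaluation by (simp add: evaluation_space_def)
  then show ?thesis
    by eventually_elim (metis ennreal_le_iff order_trans)
qed

text \<open>A function that vanishes a.e. has weighted norm 0, and evaluation at \<open>y\<close> is
  bounded by that norm.\<close>

lemma V_null_eq_0:
  assumes "v \<in> V" "v \<notin> nonzero M" "y \<in> space M"
  shows "v y = 0"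
proof -
  obtain C where "\<And>v e. v \<in> V \<Longrightarrow> 0 \<le> e \<Longrightarrow> weighted_norm M w v \<le> ennreal e \<Longrightarrow> \<bar>v y\<bar> \<le> C * e"
    using point_bound[OF assms(3)] by metis
  from this[OF assms(1), of 0] show ?thesis
    using weighted_norm_null[OF w_measurable V_measurable[OF assms(1)]] assms(2)
    by (simp add: nonzero_def)
qed

lemma L2norm_diff_less:
  assumes "u \<in> V" "v \<in> V" "weighted_dist M w u v < ennreal e"
  shows "\<bar>L2norm M u - L2norm M v\<bar> < e"
proof -
  have "u - v \<in> V" using assms V_diff by blast
  then have "ennreal (L2norm M (u - v)) < ennreal e"
    using L2norm_le_weighted_norm[of "u - v"] V_weighted assms(3) unfolding weighted_dist_def by auto
  then have "L2norm M (u - v) < e"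
    by (simp add: ennreal_less_iff L2norm_nonneg)
  with L2norm_diff[OF V_square_integrable V_square_integrable] assms(1,2) show ?thesis
    by fastforce
qed

text \<open>Evaluation at \<open>y\<close> and the L2 norm are both continuous in the weighted
  distance, so an inequality \<open>\<bar>a y\<bar> \<le> s * L2norm M a\<close> on \<open>A\<close>
  passes to limits. Serves the closure as well as the reduction to countable dense subsets. If the
  right-hand side is infinite there is nothing to prove.\<close>

lemma variation_le_of_dense:
  assumes "y \<in> space M" "A \<subseteq> V" "X \<subseteq> V"
    and dense: "\<And>u e. u \<in> X \<Longrightarrow> 0 < e \<Longrightarrow> \<exists>a\<in>A. weighted_dist M w u a < ennreal e"
  shows "variation M X y \<le> variation M A y"
proof (cases "variation M A y")
  case (real k)
  show ?thesis
  proof (rule variation_least)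
    fix u assume u: "u \<in> X" "u \<in> nonzero M"
    have uV: "u \<in> V" using u assms by auto
    have pos: "0 < L2norm M u" using V_nonzero_iff[OF uV] u by simp
    obtain C where C: "0 \<le> C" "\<And>v e. v \<in> V \<Longrightarrow> 0 \<le> e \<Longrightarrow> weighted_norm M w v \<le> ennreal e \<Longrightarrow> \<bar>v y\<bar> \<le> C * e"
      using point_bound[OF assms(1)] by metis
    define s where "s = sqrt k"
    have s: "0 \<le> s" using real by (simp add: s_def)
    have "\<bar>u y\<bar> \<le> s * L2norm M u"
    proof (rule field_le_epsilon)
      fix \<epsilon> :: real assume "0 < \<epsilon>"
      \<comment> \<open>The first bound keeps the norm of the approximating \<open>a\<close>
        positive; the second makes the total error \<open>(s + C + 1) * e\<close> at most
        \<epsilon>, the summand 1 keeping the divisor positive.\<close>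
      define e where "e = min (L2norm M u) (\<epsilon> / (s + C + 1))"
      have e: "0 < e" "e \<le> L2norm M u" "e \<le> \<epsilon> / (s + C + 1)"
        using pos \<open>0 < \<epsilon>\<close> s C(1) by (auto simp: e_def)
      obtain a where a: "a \<in> A" "weighted_dist M w u a < ennreal e"
        using dense[OF u(1) e(1)] by auto
      have aV: "a \<in> V" using a assms by auto
      have norm: "\<bar>L2norm M u - L2norm M a\<bar> < e" by (rule L2norm_diff_less[OF uV aV a(2)])
      then have "0 < L2norm M a" using e by auto
      then have "ennreal ((a y / L2norm M a)\<^sup>2) \<le> ennreal k"
        using variation_upper[of a A M y] a(1) V_nonzero_iff[OF aV] real by simp
      then have "(a y / L2norm M a)\<^sup>2 \<le> s\<^sup>2" using real by (simp add: s_def)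
      then have "\<bar>a y / L2norm M a\<bar> \<le> s" using s by (simp add: abs_le_square_iff[symmetric])
      then have "\<bar>a y\<bar> \<le> s * L2norm M a" using \<open>0 < L2norm M a\<close> by (simp add: abs_divide field_simps)
      also have "\<dots> \<le> s * (L2norm M u + e)" using norm s by (intro mult_left_mono) auto
      finally have "\<bar>a y\<bar> \<le> s * (L2norm M u + e)" .
      moreover have "\<bar>(u - a) y\<bar> \<le> C * e"
        using a(2) e by (intro C(2)[OF V_diff[OF uV aV], of e]) (auto simp: weighted_dist_def)
      ultimately have "\<bar>u y\<bar> \<le> s * L2norm M u + (s + C + 1) * e"
        using e by (simp add: algebra_simps)
      moreover have "(s + C + 1) * e \<le> \<epsilon>" using e(3) s C(1) by (simp add: field_simps)
      ultimately show "\<bar>u y\<bar> \<le> s * L2norm M u + \<epsilon>" by linarith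
    qed
    then have "\<bar>u y / L2norm M u\<bar> \<le> s" using pos by (simp add: abs_divide field_simps)
    then have "(u y / L2norm M u)\<^sup>2 \<le> s\<^sup>2" using s by (simp add: abs_le_square_iff[symmetric])
    then show "ennreal ((u y / L2norm M u)\<^sup>2) \<le> variation M A y"
      using real by (simp add: s_def ennreal_leI)
  qed
qed simp

section \<open>Invariance under closure\<close>

lemma topspace_V: "topspace (pm_topology V (weighted_dist M w)) = V"
  by (rule topspace_pm_topology) (simp add: weighted_dist_refl)

lemma variation_closure_of:
  assumes "y \<in> space M" "A \<subseteq> V"
  shows "variation M (pm_topology V (weighted_dist M w) closure_of A) y = variation M A y"
proof (rule antisym)
  let ?cl = "pm_topology V (weighted_dist M w) closure_of A"
  have clV: "?cl \<subseteq> V" using closure_of_subset_topspace[of "pm_topology V (weighted_dist M w)" A] by (simp add: topspace_V)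
  show "variation M A y \<le> variation M ?cl y"
    using assms(2) by (intro variation_mono closure_of_subset) (simp add: topspace_V)
  show "variation M ?cl y \<le> variation M A y"
  proof (rule variation_le_of_dense[OF assms clV])
    fix u e assume u: "u \<in> ?cl" and e: "0 < (e::real)"
    then have uV: "u \<in> V" using clV by auto
    let ?ball = "{v \<in> V. weighted_dist M w u v < ennreal e}"
    have meets: "\<exists>a. a \<in> A \<and> a \<in> T" if "u \<in> T" "openin (pm_topology V (weighted_dist M w)) T" for T
      using u that by (simp add: in_closure_of)
    have "u \<in> ?ball" using uV e by (simp add: weighted_dist_refl)
    from meets[OF this openin_pm_ball[OF uV e]]
    show "\<exists>a\<in>A. weighted_dist M w u a < ennreal e" by auto
  qed
qed

subsection \<open>Compact sets\<close>

context
  fixes A assumes AV: "A \<subseteq> V" and A: "compactin (pm_topology V (weighted_dist M w)) A"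
begin

lemma compact_finite_cover:
  assumes "\<And>x. x \<in> A \<Longrightarrow> 0 < e x"
  obtains T where "finite T" "T \<subseteq> A" "\<And>x. x \<in> A \<Longrightarrow> \<exists>t\<in>T. weighted_dist M w t x < ennreal (e t)"
  by (rule compactin_pm_topology_finite_cover[OF weighted_dist_refl A assms]) (auto intro: that)

text \<open>Within distance \<open>L2norm M t / 2\<close> of \<open>t\<close> the L2 norm stays
  above \<open>L2norm M t / 2\<close>; finitely many such balls cover \<open>A\<close>.\<close>

lemma compact_L2norm_lower_bound:
  assumes "A \<subseteq> nonzero M"
  obtains r where "0 < r" "\<And>a. a \<in> A \<Longrightarrow> r \<le> L2norm M a"
proof -
  have pos: "0 < L2norm M a" if "a \<in> A" for a using that assms AV V_nonzero_iff by auto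
  obtain T where T: "finite T" "T \<subseteq> A" "\<And>x. x \<in> A \<Longrightarrow> \<exists>t\<in>T. weighted_dist M w t x < ennreal (L2norm M t / 2)"
    by (rule compact_finite_cover[of "\<lambda>t. L2norm M t / 2"]) (auto simp: pos)
  \<comment> \<open>The element 1 keeps \<open>Min\<close> meaningful when \<open>T\<close>, and
    with it \<open>A\<close>, is empty.\<close>
  define r where "r = Min (insert 1 ((\<lambda>t. L2norm M t / 2) ` T))"
  show thesis
  proof (rule that[of r])
    show "0 < r" using T pos by (auto simp: r_def)
    fix a assume a: "a \<in> A"
    then obtain t where t: "t \<in> T" "weighted_dist M w t a < ennreal (L2norm M t / 2)" using T by auto
    have "\<bar>L2norm M t - L2norm M a\<bar> < L2norm M t / 2"
      using t a T AV by (intro L2norm_diff_less) auto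
    moreover have "r \<le> L2norm M t / 2" unfolding r_def using t T by (intro Min_le) auto
    ultimately show "r \<le> L2norm M a" by linarith
  qed
qed

lemma compact_weighted_norm_bound:
  obtains R where "0 \<le> R" "\<And>a. a \<in> A \<Longrightarrow> weighted_norm M w a \<le> ennreal R"
proof -
  obtain T where T: "finite T" "T \<subseteq> A" "\<And>x. x \<in> A \<Longrightarrow> \<exists>t\<in>T. weighted_dist M w t x < ennreal 1"
    by (rule compact_finite_cover[of "\<lambda>t. 1"]) auto
  define R where "R = (\<Sum>t\<in>T. weighted_norm M w t) + 1"
  have "weighted_norm M w a \<le> R" if a: "a \<in> A" for a
  proof -
    obtain t where t: "t \<in> T" "weighted_dist M w t a < ennreal 1" using T(3)[OF a] by auto
    have tV: "t \<in> V" "a \<in> V" using t T a AV by auto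
    have "weighted_norm M w (t + (a - t)) \<le> weighted_norm M w t + weighted_norm M w (a - t)"
      using tV by (intro weighted_norm_triangle V_measurable V_diff w_measurable)
    also have "\<dots> \<le> R"
      unfolding R_def using t T weighted_dist_commute[of M w t a]
      by (intro add_mono member_le_sum) (auto simp: weighted_dist_def)
    finally show ?thesis by simp
  qed
  moreover have "weighted_norm M w t < \<top>" if "t \<in> T" for t
    using that T AV V_weighted by (auto simp: weighted_space_def)
  then have "R < \<top>" using T unfolding R_def by (simp add: ennreal_sum_less_top)
  ultimately show thesis
    using that[of "enn2real R"] by simp
qed

text \<open>The union of finite nets of mesh 1 / (n + 1). It turns the variation of \<open>A\<close>
  into a countable supremum, hence a measurable function.\<close>

lemma compact_separable:
  obtains D where "countable D" "D \<subseteq> A" "\<And>a e. a \<in> A \<Longrightarrow> 0 < e \<Longrightarrow> \<exists>d\<in>D. weighted_dist M w a d < ennreal e"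
proof -
  have "\<exists>T. finite T \<and> T \<subseteq> A \<and> (\<forall>x\<in>A. \<exists>t\<in>T. weighted_dist M w t x < ennreal (1 / Suc n))" for n
    by (rule compact_finite_cover[of "\<lambda>_. 1 / Suc n"]) auto
  then obtain T where T: "\<And>n. finite (T n)" "\<And>n. T n \<subseteq> A"
    "\<And>n x. x \<in> A \<Longrightarrow> \<exists>t\<in>T n. weighted_dist M w t x < ennreal (1 / Suc n)"
    by metis
  show thesis
  proof (rule that[of "\<Union>n. T n"])
    show "countable (\<Union>n. T n)" using T by (intro countable_UN) (auto intro: countable_finite)
    show "(\<Union>n. T n) \<subseteq> A" using T by auto
    fix a e assume a: "a \<in> A" and "0 < (e::real)"
    then obtain n where n: "1 / Suc n < e" using nat_approx_posE by metis
    obtain t where "t \<in> T n" "weighted_dist M w t a < ennreal (1 / Suc n)" using T(3)[OF a] by blast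
    moreover have "ennreal (1 / Suc n) \<le> ennreal e" using n by (intro ennreal_leI) simp
    ultimately show "\<exists>d\<in>\<Union>n. T n. weighted_dist M w a d < ennreal e"
      using weighted_dist_commute[of M w a t] by (intro bexI[of _ t]) auto
  qed
qed

text \<open>Weighted norms at most \<open>R\<close> and L2 norms at least \<open>r\<close> bound all
  quotients at once. Finiteness at every point uses the evaluation constant of that point, whereas
  the weighted bound uses the a.e. estimate, whose constant does not depend on the point.\<close>

lemma compact_admissible:
  assumes "A \<subseteq> nonzero M"
  shows "admissible M w A"
proof -
  obtain r where r: "0 < r" "\<And>a. a \<in> A \<Longrightarrow> r \<le> L2norm M a"
    using compact_L2norm_lower_bound[OF assms] by metis
  obtain R where R: "0 \<le> R" "\<And>a. a \<in> A \<Longrightarrow> weighted_norm M w a \<le> ennreal R"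
    using compact_weighted_norm_bound by metis
  have quotient: "(a y / L2norm M a)\<^sup>2 \<le> (c / r)\<^sup>2" if "a \<in> A" "\<bar>a y\<bar> \<le> c" for a y c
  proof -
    have "\<bar>a y / L2norm M a\<bar> \<le> c / r"
      using that r(1) r(2)[OF that(1)] by (simp add: abs_divide frac_le)
    then show ?thesis by (intro power2_le_iff_abs_le[THEN iffD2]) (use that r in auto)
  qed
  have "variation M A y < \<top>" if y: "y \<in> space M" for y
  proof -
    obtain C where C: "0 \<le> C" "\<And>v e. v \<in> V \<Longrightarrow> 0 \<le> e \<Longrightarrow> weighted_norm M w v \<le> ennreal e \<Longrightarrow> \<bar>v y\<bar> \<le> C * e"
      using point_bound[OF y] by metis
    have "variation M A y \<le> ennreal ((C * R / r)\<^sup>2)"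
      using C(2) R AV by (intro variation_least ennreal_leI quotient) auto
    then show ?thesis using le_less_trans by fastforce
  qed
  moreover have "real_variation M A \<in> borel_measurable M"
  proof -
    obtain D where D: "countable D" "D \<subseteq> A" "\<And>a e. a \<in> A \<Longrightarrow> 0 < e \<Longrightarrow> \<exists>d\<in>D. weighted_dist M w a d < ennreal e"
      using compact_separable by metis
    have "variation M A y = variation M D y" if "y \<in> space M" for y
      using D AV that by (intro antisym variation_le_of_dense variation_mono) auto
    then have "real_variation M A y = enn2real (variation M D y)" if "y \<in> space M" for y
      using that by (simp add: real_variation_def)
    moreover have "(\<lambda>y. variation M D y) \<in> borel_measurable M"
      unfolding variation_eq_SUP
    proof (rule borel_measurable_SUP)
      show "countable (D \<inter> nonzero M)" using D(1) by auto
      fix u assume "u \<in> D \<inter> nonzero M"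
      then have [measurable]: "u \<in> borel_measurable M" using D AV V_measurable by auto
      show "(\<lambda>y. ennreal ((u y / L2norm M u)\<^sup>2)) \<in> borel_measurable M" by measurable
    qed
    ultimately show ?thesis
      by (subst measurable_cong) (auto intro: borel_measurable_enn2real)
  qed
  moreover have "weighted_norm M (\<lambda>y. (w y)\<^sup>2) (real_variation M A) \<le> ennreal ((R / r)\<^sup>2)"
  proof (rule weighted_norm_leI)
    show "AE y in M. ennreal (sqrt ((w y)\<^sup>2) * \<bar>real_variation M A y\<bar>) \<le> ennreal ((R / r)\<^sup>2)"
      using w_pos AE_point_bound
    proof eventually_elim
      fix y assume y: "0 < w y" "\<forall>v\<in>V. \<forall>e\<ge>0. weighted_norm M w v \<le> ennreal e \<longrightarrow> sqrt (w y) * \<bar>v y\<bar> \<le> e"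
      \<comment> \<open>The a.e. estimate reads \<open>\<bar>a y\<bar> \<le> R / sqrt (w y)\<close>;
        after squaring, \<open>w y\<close> times the variation is bounded, which is the norm with
        weight \<open>w\<^sup>2\<close>.\<close>
      have "real_variation M A y \<le> (R / sqrt (w y) / r)\<^sup>2"
      proof (rule real_variation_least)
        fix a assume a: "a \<in> A"
        then have "sqrt (w y) * \<bar>a y\<bar> \<le> R" using y(2) R AV by auto
        then show "(a y / L2norm M a)\<^sup>2 \<le> (R / sqrt (w y) / r)\<^sup>2"
          using a y(1) by (intro quotient) (auto simp: field_simps)
      qed simp
      then have "w y * real_variation M A y \<le> (R / r)\<^sup>2"
        using y(1) r(1) by (simp add: power_divide field_simps)
      moreover have "0 \<le> real_variation M A y" by (simp add: real_variation_def)
      ultimately show "ennreal (sqrt ((w y)\<^sup>2) * \<bar>real_variation M A y\<bar>) \<le> ennreal ((R / r)\<^sup>2)"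
        using y(1) by (simp add: ennreal_leI)
    qed
  qed (measurable, fact)
  ultimately show ?thesis
    unfolding admissible_def weighted_space_def by (auto intro: le_less_trans)
qed

end

end

subsection \<open>Continuity of the variation function\<close>

text \<open>The difference is split so that the change of denominators is multiplied by
  \<open>p / \<alpha>\<close>, the quotient that \<open>S\<close> bounds.\<close>

lemma quotient_perturbation:
  fixes p q \<alpha> \<beta> :: real
  assumes "0 < r" "r \<le> \<alpha>" "r \<le> \<beta>" "0 \<le> p" "0 \<le> S"
    and "\<bar>p - q\<bar> \<le> \<eta>" "\<bar>\<alpha> - \<beta>\<bar> \<le> \<eta>" "p \<le> S * \<alpha>"
  shows "\<bar>p / \<alpha> - q / \<beta>\<bar> \<le> \<eta> * (1 + S) / r"
proof -
  have pos: "0 < \<alpha>" "0 < \<beta>" using assms by auto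
  have "p / \<alpha> - q / \<beta> = (p - q) / \<beta> + p / \<alpha> * ((\<beta> - \<alpha>) / \<beta>)"
    using pos by (simp add: field_simps)
  also have "\<bar>\<dots>\<bar> \<le> \<bar>p - q\<bar> / \<beta> + p / \<alpha> * (\<bar>\<alpha> - \<beta>\<bar> / \<beta>)"
    using pos assms(4) by (intro order_trans[OF abs_triangle_ineq]) (simp add: abs_mult abs_divide abs_minus_commute)
  also have "\<dots> \<le> \<eta> / r + S * (\<eta> / r)"
    using pos assms by (intro add_mono mult_mono frac_le) (auto simp: field_simps)
  also have "\<dots> = \<eta> * (1 + S) / r" by (simp add: add_divide_distrib distrib_left mult.commute)
  finally show ?thesis .
qed

text \<open>Factor the difference of squares; \<open>s + t\<close> is at most
  \<open>2 * S + \<epsilon>\<close>, because \<open>t\<close> exceeds \<open>s\<close> by at most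
  \<epsilon>.\<close>

lemma square_perturbation:
  fixes s t :: real
  assumes "0 \<le> s" "0 \<le> t" "s \<le> S" "\<bar>s - t\<bar> \<le> \<epsilon>"
  shows "s\<^sup>2 \<le> t\<^sup>2 + \<epsilon> * (2 * S + \<epsilon>)" "t\<^sup>2 \<le> s\<^sup>2 + \<epsilon> * (2 * S + \<epsilon>)"
proof -
  have "\<bar>s - t\<bar> * \<bar>s + t\<bar> \<le> \<epsilon> * (2 * S + \<epsilon>)"
    using assms by (intro mult_mono) auto
  moreover have "\<bar>s\<^sup>2 - t\<^sup>2\<bar> = \<bar>s - t\<bar> * \<bar>s + t\<bar>"
    by (simp add: abs_mult[symmetric] power2_eq_square algebra_simps)
  ultimately show "s\<^sup>2 \<le> t\<^sup>2 + \<epsilon> * (2 * S + \<epsilon>)" "t\<^sup>2 \<le> s\<^sup>2 + \<epsilon> * (2 * S + \<epsilon>)"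
    by linarith+
qed

context point_evaluation_space
begin

text \<open>Only the quotients of \<open>A\<close> are bounded by \<open>S\<close>: each quotient of
  \<open>B\<close> lies within \<epsilon> of one of \<open>A\<close>. Continuity at a given set thus
  needs no uniform bound on its neighbours.\<close>

lemma real_variation_perturbation:
  assumes AV: "A \<subseteq> V" and BV: "B \<subseteq> V"
    and close: "hausdorff_dist (weighted_dist M w) A B < ennreal \<eta>"
    and r: "0 < r" "\<And>u. u \<in> A \<union> B \<Longrightarrow> r \<le> L2norm M u"
    and fin: "variation M A y < \<top>" "variation M B y < \<top>"
    and wy: "0 < w y"
    and point: "\<forall>v\<in>V. \<forall>e\<ge>0. weighted_norm M w v \<le> ennreal e \<longrightarrow> sqrt (w y) * \<bar>v y\<bar> \<le> e"
    and S: "0 \<le> S" "w y * real_variation M A y \<le> S\<^sup>2"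
    and \<epsilon>: "\<epsilon> = \<eta> * (1 + S) / r"
  shows "w y * \<bar>real_variation M A y - real_variation M B y\<bar> \<le> \<epsilon> * (2 * S + \<epsilon>)"
proof -
  define q where "q u = sqrt (w y) * \<bar>u y\<bar> / L2norm M u" for u
  have \<eta>: "0 < \<eta>" using close by (metis ennreal_neg gr_implies_not_zero not_le_imp_less)
  have \<epsilon>_nonneg: "0 \<le> \<epsilon>" using \<eta> S r(1) by (simp add: \<epsilon>)
  have q_sq: "(q u)\<^sup>2 = w y * (u y / L2norm M u)\<^sup>2" for u
    using wy by (simp add: q_def power_mult_distrib power_divide)
  have q_nonneg: "0 \<le> q u" for u using wy by (simp add: q_def L2norm_nonneg)
  have nonzero: "u \<in> nonzero M" if "u \<in> A \<union> B" for u
    using that r(1) r(2)[OF that] AV BV V_nonzero_iff[of u] by auto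
  have q_le: "(q u)\<^sup>2 \<le> w y * real_variation M X y" if "u \<in> X" "X = A \<or> X = B" for u X
    unfolding q_sq using that wy nonzero[of u] fin by (intro mult_left_mono real_variation_upper) auto
  have q_le_S: "q a \<le> S" if "a \<in> A" for a
    using q_le[of a A] that S by (intro power2_le_imp_le[of "q a" S]) auto
  have q_close: "\<bar>q a - q b\<bar> \<le> \<epsilon>" if "a \<in> A" "b \<in> B" "weighted_dist M w a b < ennreal \<eta>" for a b
  proof -
    have V: "a \<in> V" "b \<in> V" using that AV BV by auto
    have "weighted_norm M w (a - b) \<le> ennreal \<eta>"
      using that(3) unfolding weighted_dist_def by (rule less_imp_le)
    then have "sqrt (w y) * \<bar>(a - b) y\<bar> \<le> \<eta>"
      using point V_diff[OF V] \<eta> by auto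
    moreover have "\<bar>sqrt (w y) * \<bar>a y\<bar> - sqrt (w y) * \<bar>b y\<bar>\<bar> = sqrt (w y) * \<bar>\<bar>a y\<bar> - \<bar>b y\<bar>\<bar>"
      using wy by (simp add: right_diff_distrib[symmetric] abs_mult)
    moreover have "\<dots> \<le> sqrt (w y) * \<bar>(a - b) y\<bar>"
      using wy by (intro mult_left_mono) auto
    ultimately have 1: "\<bar>sqrt (w y) * \<bar>a y\<bar> - sqrt (w y) * \<bar>b y\<bar>\<bar> \<le> \<eta>" by linarith
    have 2: "\<bar>L2norm M a - L2norm M b\<bar> \<le> \<eta>" using L2norm_diff_less[OF V that(3)] by simp
    have ra: "r \<le> L2norm M a" "r \<le> L2norm M b" using r that by auto
    have 3: "sqrt (w y) * \<bar>a y\<bar> \<le> S * L2norm M a"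
      using q_le_S[OF that(1)] ra r(1) by (simp add: q_def field_simps)
    show ?thesis
      unfolding q_def \<epsilon> using wy by (intro quotient_perturbation r(1) ra 1 2 3 S(1)) auto
  qed
  \<comment> \<open>Both directions share this passage from single quotients to suprema; dividing by
    \<open>w y\<close> brings the bound into the form of an upper bound for the supremum.\<close>
  have le: "w y * real_variation M X y \<le> w y * real_variation M Z y + \<epsilon> * (2 * S + \<epsilon>)"
    if XZ: "X = A \<or> X = B" "Z = A \<or> Z = B"
      and step: "\<And>u. u \<in> X \<Longrightarrow> \<exists>v\<in>Z. (q u)\<^sup>2 \<le> (q v)\<^sup>2 + \<epsilon> * (2 * S + \<epsilon>)" for X Z
  proof -
    have "real_variation M X y \<le> (w y * real_variation M Z y + \<epsilon> * (2 * S + \<epsilon>)) / w y"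
    proof (rule real_variation_least)
      show "0 \<le> (w y * real_variation M Z y + \<epsilon> * (2 * S + \<epsilon>)) / w y"
        using wy \<epsilon>_nonneg S(1) by (simp add: real_variation_def)
      fix u assume "u \<in> X"
      then obtain v where v: "v \<in> Z" "(q u)\<^sup>2 \<le> (q v)\<^sup>2 + \<epsilon> * (2 * S + \<epsilon>)" using step by blast
      have "w y * (u y / L2norm M u)\<^sup>2 \<le> w y * real_variation M Z y + \<epsilon> * (2 * S + \<epsilon>)"
        using v(2) q_le[OF v(1) XZ(2)] unfolding q_sq by linarith
      then show "(u y / L2norm M u)\<^sup>2 \<le> (w y * real_variation M Z y + \<epsilon> * (2 * S + \<epsilon>)) / w y"
        using wy by (simp add: pos_le_divide_eq mult.commute)
    qed
    then show ?thesis using wy by (simp add: pos_le_divide_eq mult.commute)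
  qed
  have "w y * real_variation M A y \<le> w y * real_variation M B y + \<epsilon> * (2 * S + \<epsilon>)"
  proof (rule le)
    fix a assume a: "a \<in> A"
    obtain b where b: "b \<in> B" "weighted_dist M w a b < ennreal \<eta>"
      using hausdorff_dist_lessD1[OF close a] by blast
    show "\<exists>b\<in>B. (q a)\<^sup>2 \<le> (q b)\<^sup>2 + \<epsilon> * (2 * S + \<epsilon>)"
      using square_perturbation(1)[OF q_nonneg q_nonneg q_le_S[OF a] q_close[OF a b]] b by blast
  qed auto
  moreover have "w y * real_variation M B y \<le> w y * real_variation M A y + \<epsilon> * (2 * S + \<epsilon>)"
  proof (rule le)
    fix b assume b: "b \<in> B"
    obtain a where a: "a \<in> A" "weighted_dist M w a b < ennreal \<eta>"
      using hausdorff_dist_lessD2[OF close b] by blast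
    show "\<exists>a\<in>A. (q b)\<^sup>2 \<le> (q a)\<^sup>2 + \<epsilon> * (2 * S + \<epsilon>)"
      using square_perturbation(2)[OF q_nonneg q_nonneg q_le_S[OF a(1)] q_close[OF a(1) b a(2)]] a by blast
  qed auto
  moreover have "w y * \<bar>real_variation M A y - real_variation M B y\<bar>
      = \<bar>w y * real_variation M A y - w y * real_variation M B y\<bar>"
    using wy by (simp add: right_diff_distrib[symmetric] abs_mult)
  ultimately show ?thesis by linarith
qed

lemma weighted_sq_AE_bound:
  assumes "admissible M w A"
  obtains S where "0 \<le> S" "AE y in M. w y * real_variation M A y \<le> S\<^sup>2"
proof -
  define c where "c = enn2real (weighted_norm M (\<lambda>y. (w y)\<^sup>2) (real_variation M A))"
  have c: "weighted_norm M (\<lambda>y. (w y)\<^sup>2) (real_variation M A) = ennreal c" "0 \<le> c"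
    using assms by (auto simp: admissible_def weighted_space_def c_def)
  have "AE y in M. w y * real_variation M A y \<le> (sqrt c)\<^sup>2"
    using w_pos weighted_norm_AE[where M = M and w = "\<lambda>y. (w y)\<^sup>2" and v = "real_variation M A"]
  proof eventually_elim
    fix y assume "0 < w y"
      "ennreal (sqrt ((w y)\<^sup>2) * \<bar>real_variation M A y\<bar>) \<le> weighted_norm M (\<lambda>y. (w y)\<^sup>2) (real_variation M A)"
    then show "w y * real_variation M A y \<le> (sqrt c)\<^sup>2"
      using c by (simp add: real_variation_def)
  qed
  then show thesis using that[of "sqrt c"] c(2) by simp
qed

text \<open>The map \<^term>\<open>\<phi>\<close> is the identity, or the truncation to the unit sphere.\<close>

lemma continuous_map_real_variation:
  assumes D: "\<And>X. X \<in> D \<Longrightarrow> \<phi> X \<subseteq> V" "\<And>X. X \<in> D \<Longrightarrow> admissible M w (\<phi> X)"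
      "\<And>X. X \<in> D \<Longrightarrow> real_variation M X = real_variation M (\<phi> X)"
    and d: "\<And>X Y. d X Y = hausdorff_dist (weighted_dist M w) (\<phi> X) (\<phi> Y)"
    and lower: "\<And>X. X \<in> D \<Longrightarrow> \<exists>r>0. \<exists>\<delta>>0. \<forall>Y\<in>D. d X Y < ennreal \<delta> \<longrightarrow>
      (\<forall>u\<in>\<phi> X \<union> \<phi> Y. r \<le> L2norm M u)"
  shows "continuous_map (pm_topology D d)
    (pm_topology (weighted_space M (\<lambda>y. (w y)\<^sup>2)) (weighted_dist M (\<lambda>y. (w y)\<^sup>2)))
    (real_variation M)"
proof (rule continuous_map_pm_topology)
  have w2: "(\<lambda>y. (w y)\<^sup>2) \<in> borel_measurable M" by measurable
  show "d X X = 0" for X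
    by (simp add: d hausdorff_dist_refl weighted_dist_refl)
  show "real_variation M X \<in> weighted_space M (\<lambda>y. (w y)\<^sup>2)" if "X \<in> D" for X
    using D(2,3)[OF that] by (simp add: admissible_def)
  show "weighted_dist M (\<lambda>y. (w y)\<^sup>2) u u = 0" for u
    by (rule weighted_dist_refl[OF w2])
  show "weighted_dist M (\<lambda>y. (w y)\<^sup>2) t v
      \<le> weighted_dist M (\<lambda>y. (w y)\<^sup>2) t u + weighted_dist M (\<lambda>y. (w y)\<^sup>2) u v"
    if "t \<in> weighted_space M (\<lambda>y. (w y)\<^sup>2)" "u \<in> weighted_space M (\<lambda>y. (w y)\<^sup>2)"
      "v \<in> weighted_space M (\<lambda>y. (w y)\<^sup>2)" for t u v
    using that by (intro weighted_dist_triangle w2) (auto dest: weighted_space_measurable)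
  fix X e assume X: "X \<in> D" and e: "0 < (e::real)"
  obtain r \<delta>0 where r: "0 < r" "0 < \<delta>0"
    "\<And>Y u. Y \<in> D \<Longrightarrow> d X Y < ennreal \<delta>0 \<Longrightarrow> u \<in> \<phi> X \<union> \<phi> Y \<Longrightarrow> r \<le> L2norm M u"
    using lower[OF X] by blast
  obtain S where S: "0 \<le> S" "AE y in M. w y * real_variation M (\<phi> X) y \<le> S\<^sup>2"
    using weighted_sq_AE_bound[OF D(2)[OF X]] by metis
  \<comment> \<open>The bound 1 gives \<open>2 * S + \<epsilon> \<le> 2 * S + 1\<close>, the other
    one makes the product at most \<open>e / 2\<close>; \<eta> then inverts the formula for
    \<epsilon>. Aiming at \<open>e / 2\<close> recovers a strict inequality from the essential
    supremum.\<close>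
  define \<epsilon>0 where "\<epsilon>0 = min 1 (e / (2 * (2 * S + 1)))"
  define \<eta> where "\<eta> = min \<delta>0 (\<epsilon>0 * r / (1 + S))"
  define \<epsilon> where "\<epsilon> = \<eta> * (1 + S) / r"
  have \<epsilon>0: "0 < \<epsilon>0" using e S by (simp add: \<epsilon>0_def)
  have \<eta>: "0 < \<eta>" "\<eta> \<le> \<delta>0" using r \<epsilon>0 S by (auto simp: \<eta>_def)
  have "\<eta> \<le> \<epsilon>0 * r / (1 + S)" by (simp add: \<eta>_def)
  then have \<epsilon>: "0 \<le> \<epsilon>" "\<epsilon> \<le> \<epsilon>0" using r S \<eta> by (auto simp: \<epsilon>_def field_simps)
  have cancel: "e / (2 * k) * k = e / 2" if "0 < k" for k using that by simp
  have "\<epsilon> * (2 * S + \<epsilon>) \<le> \<epsilon>0 * (2 * S + 1)"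
    using \<epsilon> S by (intro mult_mono) (auto simp: \<epsilon>0_def)
  also have "\<dots> \<le> e / (2 * (2 * S + 1)) * (2 * S + 1)"
    using S by (intro mult_right_mono) (auto simp: \<epsilon>0_def)
  also have "\<dots> = e / 2" using cancel[of "2 * S + 1"] S(1) by linarith
  finally have small: "\<epsilon> * (2 * S + \<epsilon>) \<le> e / 2" .
  show "\<exists>\<delta>>0. \<forall>X'\<in>D. d X X' < ennreal \<delta> \<longrightarrow>
      weighted_dist M (\<lambda>y. (w y)\<^sup>2) (real_variation M X) (real_variation M X') < ennreal e"
  proof (intro exI[of _ \<eta>] conjI ballI impI \<eta>(1))
    fix Y assume Y: "Y \<in> D" and close: "d X Y < ennreal \<eta>"
    have "d X Y < ennreal \<delta>0" using close \<eta>(2) by (meson ennreal_leI less_le_trans)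
    note lb = r(3)[OF Y this]
    have meas: "real_variation M (\<phi> X) - real_variation M (\<phi> Y) \<in> borel_measurable M"
      using D(2)[OF X] D(2)[OF Y] unfolding fun_diff_def admissible_def weighted_space_def
      by (intro borel_measurable_diff) auto
    have "weighted_dist M (\<lambda>y. (w y)\<^sup>2) (real_variation M (\<phi> X)) (real_variation M (\<phi> Y)) \<le> ennreal (e / 2)"
      unfolding weighted_dist_def
    proof (rule weighted_norm_leI[OF w2 meas])
      show "AE y in M. ennreal (sqrt ((w y)\<^sup>2) * \<bar>(real_variation M (\<phi> X) - real_variation M (\<phi> Y)) y\<bar>)
          \<le> ennreal (e / 2)"
        using AE_space w_pos AE_point_bound S(2)
      proof eventually_elim
        fix y assume y: "y \<in> space M" "0 < w y"
          "\<forall>v\<in>V. \<forall>e\<ge>0. weighted_norm M w v \<le> ennreal e \<longrightarrow> sqrt (w y) * \<bar>v y\<bar> \<le> e"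
          "w y * real_variation M (\<phi> X) y \<le> S\<^sup>2"
        have "w y * \<bar>real_variation M (\<phi> X) y - real_variation M (\<phi> Y) y\<bar> \<le> \<epsilon> * (2 * S + \<epsilon>)"
          using D(2)[OF X] D(2)[OF Y] y(1) close
          by (intro real_variation_perturbation[OF D(1)[OF X] D(1)[OF Y] _ r(1) lb _ _ y(2,3) S(1) y(4) \<epsilon>_def])
             (auto simp: admissible_def d)
        then show "ennreal (sqrt ((w y)\<^sup>2) * \<bar>(real_variation M (\<phi> X) - real_variation M (\<phi> Y)) y\<bar>)
          \<le> ennreal (e / 2)"
          using y(2) small by (intro ennreal_leI) simp
      qed
    qed
    also have "\<dots> < ennreal e" using e by (simp add: ennreal_less_iff)
    finally show "weighted_dist M (\<lambda>y. (w y)\<^sup>2) (real_variation M X) (real_variation M Y) < ennreal e"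
      using D(3)[OF X] D(3)[OF Y] by simp
  qed
qed

section \<open>Continuity on compact sets, away from 0, and on cones\<close>

lemma continuous_map_real_variation_compact:
  "continuous_map
    (pm_topology {A. A \<noteq> {} \<and> A \<subseteq> V \<inter> nonzero M \<and> compactin (pm_topology V (weighted_dist M w)) A}
      (hausdorff_dist (weighted_dist M w)))
    (pm_topology (weighted_space M (\<lambda>y. (w y)\<^sup>2)) (weighted_dist M (\<lambda>y. (w y)\<^sup>2)))
    (real_variation M)"
proof (rule continuous_map_real_variation[where \<phi> = "\<lambda>X. X"])
  let ?D = "{A. A \<noteq> {} \<and> A \<subseteq> V \<inter> nonzero M \<and> compactin (pm_topology V (weighted_dist M w)) A}"
  fix X assume X: "X \<in> ?D"
  show "X \<subseteq> V" using X by auto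
  show "admissible M w X" using X by (intro compact_admissible) auto
  obtain r where r: "0 < r" "\<And>a. a \<in> X \<Longrightarrow> r \<le> L2norm M a"
    using compact_L2norm_lower_bound[of X] X by auto
  \<comment> \<open>Half of the lower bound of \<open>X\<close> is given up for the distance from
    \<open>X\<close> to \<open>Y\<close>.\<close>
  have "r / 2 \<le> L2norm M u"
    if Y: "Y \<in> ?D" and close: "hausdorff_dist (weighted_dist M w) X Y < ennreal (r / 2)"
      and u: "u \<in> X \<union> Y" for Y u
  proof (cases "u \<in> X")
    case True
    then show ?thesis using r(2)[of u] r(1) by simp
  next
    case False
    then have "u \<in> Y" using u by simp
    then obtain x where x: "x \<in> X" "weighted_dist M w x u < ennreal (r / 2)"
      using hausdorff_dist_lessD2[OF close] by blast
    have "\<bar>L2norm M x - L2norm M u\<bar> < r / 2"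
      using x X Y \<open>u \<in> Y\<close> by (intro L2norm_diff_less) auto
    with r(2)[OF x(1)] show ?thesis by linarith
  qed
  then show "\<exists>r>0. \<exists>\<delta>>0. \<forall>Y\<in>?D. hausdorff_dist (weighted_dist M w) X Y < ennreal \<delta> \<longrightarrow>
      (\<forall>u\<in>X \<union> Y. r \<le> L2norm M u)"
    using r(1) by (intro exI[of _ "r / 2"] conjI ballI impI) auto
qed auto

lemma continuous_map_real_variation_away_from_0:
  assumes "0 < r"
  shows "continuous_map
    (pm_topology {A. A \<subseteq> V - {v. L2norm M v < r} \<and> admissible M w A}
      (hausdorff_dist (weighted_dist M w)))
    (pm_topology (weighted_space M (\<lambda>y. (w y)\<^sup>2)) (weighted_dist M (\<lambda>y. (w y)\<^sup>2)))
    (real_variation M)"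
proof (rule continuous_map_real_variation[where \<phi> = "\<lambda>X. X"])
  fix X assume X: "X \<in> {A. A \<subseteq> V - {v. L2norm M v < r} \<and> admissible M w A}"
  show "\<exists>r'>0. \<exists>\<delta>>0. \<forall>Y\<in>{A. A \<subseteq> V - {v. L2norm M v < r} \<and> admissible M w A}.
      hausdorff_dist (weighted_dist M w) X Y < ennreal \<delta> \<longrightarrow> (\<forall>u\<in>X \<union> Y. r' \<le> L2norm M u)"
    \<comment> \<open>The lower bound is built into the domain, so the radius 1 is
      arbitrary.\<close>
    by (rule exI[of _ r], intro conjI assms exI[of _ 1] ballI impI)
       (use X in \<open>auto simp: not_less subset_eq\<close>)
qed auto

text \<open>The quotient is invariant under positive scaling, and dividing by the positive number
  \<open>L2norm M u\<close> does not leave the cone.\<close>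

lemma variation_open_cone:
  assumes "open_cone A" "A \<subseteq> V"
  shows "variation M ({v. L2norm M v = 1} \<inter> A) y = variation M A y"
proof (rule antisym)
  show "variation M A y \<le> variation M ({v. L2norm M v = 1} \<inter> A) y"
  proof (rule variation_least)
    fix u assume u: "u \<in> A" "u \<in> nonzero M"
    then have pos: "0 < L2norm M u" using V_nonzero_iff assms by auto
    obtain X where X: "A = {c *\<^sub>R x | c x. 0 < c \<and> x \<in> X}"
      using assms(1) by (auto simp: open_cone_def)
    obtain c x where c: "u = c *\<^sub>R x" "0 < c" "x \<in> X" using u X by auto
    define v where "v = (1 / L2norm M u) *\<^sub>R u"
    have "v = (c / L2norm M u) *\<^sub>R x" by (simp add: v_def c(1))
    moreover have "0 < c / L2norm M u" using c(2) pos by simp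
    ultimately have vA: "v \<in> A" unfolding X using c(3) by blast
    have v1: "L2norm M v = 1" using pos by (simp add: v_def L2norm_scaleR)
    have "v \<in> nonzero M" using vA v1 V_nonzero_iff[of v] assms(2) by auto
    from variation_upper[OF _ this, of "{v. L2norm M v = 1} \<inter> A" y]
    show "ennreal ((u y / L2norm M u)\<^sup>2) \<le> variation M ({v. L2norm M v = 1} \<inter> A) y"
      using vA v1 by (simp add: v_def scaleR_fun_def)
  qed
qed (simp add: variation_mono)

text \<open>A cone itself contains elements of arbitrarily small norm as soon as it is nonempty; its
  truncation has all norms equal to 1, which supplies the lower bound.\<close>

lemma continuous_map_real_variation_cones:
  "continuous_map
    (pm_topology {A. A \<subseteq> V \<and> open_cone A \<and> admissible M w A}
      (truncated_hausdorff_dist M (weighted_dist M w)))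
    (pm_topology (weighted_space M (\<lambda>y. (w y)\<^sup>2)) (weighted_dist M (\<lambda>y. (w y)\<^sup>2)))
    (real_variation M)"
proof (rule continuous_map_real_variation[where \<phi> = "\<lambda>X. {v. L2norm M v = 1} \<inter> X"])
  fix X assume "X \<in> {A. A \<subseteq> V \<and> open_cone A \<and> admissible M w A}"
  then have X: "X \<subseteq> V" "open_cone X" "admissible M w X" by auto
  show "{v. L2norm M v = 1} \<inter> X \<subseteq> V" using X by auto
  have eq: "variation M ({v. L2norm M v = 1} \<inter> X) = variation M X"
    using variation_open_cone[OF X(2,1)] by auto
  then show "real_variation M X = real_variation M ({v. L2norm M v = 1} \<inter> X)"
    by (simp add: real_variation_def)
  with eq show "admissible M w ({v. L2norm M v = 1} \<inter> X)" using X(3) by (simp add: admissible_def)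
qed (auto simp: truncated_hausdorff_dist_def intro!: exI[of _ 1])

end

subsection \<open>Sums and products\<close>

text \<open>Cauchy-Schwarz in the plane, with defect
  \<open>(s * \<beta> - t * \<alpha>)\<^sup>2\<close> for \<open>s = a / \<alpha>\<close> and
  \<open>t = b / \<beta>\<close>.\<close>

lemma sum_square_quotient_le:
  fixes a b \<alpha> \<beta> :: real
  assumes "0 < \<alpha>" "0 < \<beta>"
  shows "(a + b)\<^sup>2 / (\<alpha>\<^sup>2 + \<beta>\<^sup>2) \<le> (a / \<alpha>)\<^sup>2 + (b / \<beta>)\<^sup>2"
proof -
  define s t where "s = a / \<alpha>" and "t = b / \<beta>"
  have ab: "a = s * \<alpha>" "b = t * \<beta>" using assms by (simp_all add: s_def t_def)
  have "(s\<^sup>2 + t\<^sup>2) * (\<alpha>\<^sup>2 + \<beta>\<^sup>2) - (a + b)\<^sup>2 = (s * \<beta> - t * \<alpha>)\<^sup>2"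
    unfolding ab by (simp add: power2_eq_square algebra_simps)
  then have "(a + b)\<^sup>2 \<le> (s\<^sup>2 + t\<^sup>2) * (\<alpha>\<^sup>2 + \<beta>\<^sup>2)"
    using zero_le_power2[of "s * \<beta> - t * \<alpha>"] by linarith
  then show ?thesis
    using assms by (simp add: pos_divide_le_eq s_def[symmetric] t_def[symmetric] add_pos_pos)
qed

context point_evaluation_space
begin

text \<open>By Pythagoras the denominator is the sum of two squares. If one summand vanishes a.e.,
  it vanishes at \<open>y\<close> too and only the quotient of the other remains.\<close>

lemma variation_add_le:
  assumes AV: "A \<subseteq> V" and BV: "B \<subseteq> V" and orth: "L2_orthogonal M A B" and y: "y \<in> space M"
  shows "variation M (A + B) y \<le> variation M A y + variation M B y"
proof (rule variation_least)
  fix u assume "u \<in> A + B" and u0: "u \<in> nonzero M"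
  then obtain a b where u: "u = a + b" "a \<in> A" "b \<in> B" by (auto elim: set_plus_elim)
  have V: "a \<in> V" "b \<in> V" using u AV BV by auto
  have norm: "(L2norm M u)\<^sup>2 = (L2norm M a)\<^sup>2 + (L2norm M b)\<^sup>2"
    using L2norm_add_sq[OF V_square_integrable[OF V(1)] V_square_integrable[OF V(2)]] orth u
    by (simp add: L2_orthogonal_def)
  have null: "L2norm M v = 0" "v y = 0" if "v \<in> V" "v \<notin> nonzero M" for v
    using that V_nonzero_iff[of v] L2norm_nonneg[of M v] V_null_eq_0[OF that y] by auto
  have u_pos: "0 < L2norm M u"
    using u0 V_nonzero_iff[of u] subspace_add[OF subspace_V V] u(1) by simp
  have uy: "(u y / L2norm M u)\<^sup>2 = (a y + b y)\<^sup>2 / ((L2norm M a)\<^sup>2 + (L2norm M b)\<^sup>2)"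
    by (simp add: power_divide norm[symmetric] u(1))
  consider "a \<notin> nonzero M" | "b \<notin> nonzero M" | "a \<in> nonzero M" "b \<in> nonzero M" by auto
  then show "ennreal ((u y / L2norm M u)\<^sup>2) \<le> variation M A y + variation M B y"
  proof cases
    case 1
    then have eq: "(u y / L2norm M u)\<^sup>2 = (b y / L2norm M b)\<^sup>2"
      using null[OF V(1)] unfolding uy by (simp add: power_divide)
    have "b \<in> nonzero M"
      using null[OF V(1) 1] null(1)[OF V(2)] norm u_pos by (cases "b \<in> nonzero M") auto
    then show ?thesis unfolding eq using variation_upper[OF u(3), of M y] by (simp add: add_increasing)
  next
    case 2
    then have eq: "(u y / L2norm M u)\<^sup>2 = (a y / L2norm M a)\<^sup>2"
      using null[OF V(2)] unfolding uy by (simp add: power_divide)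
    have "a \<in> nonzero M"
      using null[OF V(2) 2] null(1)[OF V(1)] norm u_pos by (cases "a \<in> nonzero M") auto
    then show ?thesis unfolding eq using variation_upper[OF u(2), of M y] by (simp add: add_increasing2)
  next
    case 3
    then have "(u y / L2norm M u)\<^sup>2 \<le> (a y / L2norm M a)\<^sup>2 + (b y / L2norm M b)\<^sup>2"
      unfolding uy using V V_nonzero_iff by (intro sum_square_quotient_le) auto
    then have "ennreal ((u y / L2norm M u)\<^sup>2)
        \<le> ennreal ((a y / L2norm M a)\<^sup>2) + ennreal ((b y / L2norm M b)\<^sup>2)"
      by (simp add: ennreal_plus[symmetric] ennreal_leI del: ennreal_plus)
    also have "\<dots> \<le> variation M A y + variation M B y"
      using 3 u by (intro add_mono variation_upper) auto
    finally show ?thesis .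
  qed
qed

text \<open>Given normalised \<^term>\<open>a\<close> and \<^term>\<open>b\<close>, the combination with coefficients \<^term>\<open>a y\<close> and
  \<^term>\<open>b y\<close> attains the sum of their contributions.\<close>

lemma variation_add_ge:
  assumes AV: "A \<subseteq> V" and BV: "B \<subseteq> V" and orth: "L2_orthogonal M A B" and y: "y \<in> space M"
    and sub: "subspace A" "subspace B"
  shows "variation M A y + variation M B y \<le> variation M (A + B) y"
proof -
  let ?K = "variation M (A + B) y"
  have "A \<subseteq> A + B" "B \<subseteq> A + B"
    using set_plus_intro[of _ A 0 B] set_plus_intro[of 0 A _ B] subspace_0[OF sub(1)] subspace_0[OF sub(2)]
    by auto
  then have single: "variation M A y \<le> ?K" "variation M B y \<le> ?K"
    by (auto intro: variation_mono)
  have pair: "ennreal ((a y / L2norm M a)\<^sup>2) + ennreal ((b y / L2norm M b)\<^sup>2) \<le> ?K"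
    if ab: "a \<in> A" "b \<in> B" "a \<in> nonzero M" "b \<in> nonzero M" for a b
  proof -
    define \<alpha> \<beta> where "\<alpha> = L2norm M a" and "\<beta> = L2norm M b"
    have V: "a \<in> V" "b \<in> V" using ab AV BV by auto
    have pos: "0 < \<alpha>" "0 < \<beta>" using ab V V_nonzero_iff by (auto simp: \<alpha>_def \<beta>_def)
    \<comment> \<open>As \<open>a\<close> and \<open>b\<close> are not normalised, their squared
      norms divide the coefficients. The sum \<open>a' + b'\<close> then has value \<open>s\<close>
      at \<open>y\<close> and squared norm \<open>s\<close>, so its contribution is
      \<open>s\<^sup>2 / s\<close>.\<close>
    define a' b' where "a' = (a y / \<alpha>\<^sup>2) *\<^sub>R a" and "b' = (b y / \<beta>\<^sup>2) *\<^sub>R b"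
    have in': "a' \<in> A" "b' \<in> B" using ab sub by (auto simp: a'_def b'_def subspace_scale)
    then have V': "a' \<in> V" "b' \<in> V" "a' + b' \<in> V" using AV BV subspace_add[OF subspace_V] by auto
    define s where "s = (a y / \<alpha>)\<^sup>2 + (b y / \<beta>)\<^sup>2"
    have val: "(a' + b') y = s"
      by (simp add: a'_def b'_def s_def scaleR_fun_def power2_eq_square)
    have "(L2norm M (a' + b'))\<^sup>2 = (L2norm M a')\<^sup>2 + (L2norm M b')\<^sup>2"
      using L2norm_add_sq[OF V_square_integrable[OF V'(1)] V_square_integrable[OF V'(2)]] orth in'
      by (simp add: L2_orthogonal_def)
    moreover have "(L2norm M a')\<^sup>2 = (a y / \<alpha>)\<^sup>2" "(L2norm M b')\<^sup>2 = (b y / \<beta>)\<^sup>2"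
      using pos by (simp_all add: a'_def b'_def L2norm_scaleR \<alpha>_def[symmetric] \<beta>_def[symmetric]
          power_mult_distrib power_divide power2_eq_square)
    ultimately have norm: "(L2norm M (a' + b'))\<^sup>2 = s" by (simp add: s_def)
    have "ennreal s \<le> ?K"
    proof (cases "s = 0")
      case False
      have "0 \<le> s" by (simp add: s_def)
      have "L2norm M (a' + b') \<noteq> 0" using norm False by auto
      then have "a' + b' \<in> nonzero M"
        using V_nonzero_iff[OF V'(3)] L2norm_nonneg[of M "a' + b'"] by simp
      from variation_upper[OF set_plus_intro[OF in'] this, of y]
      show ?thesis
        using False unfolding power_divide norm val by (simp add: power2_eq_square)
    qed simp
    then show ?thesis
      by (simp add: s_def \<alpha>_def \<beta>_def ennreal_plus[symmetric] del: ennreal_plus)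
  qed
  show ?thesis
  \<comment> \<open>A constant summand can be moved into a supremum only over a nonempty index
    set.\<close>
  proof (cases "A \<inter> nonzero M = {} \<or> B \<inter> nonzero M = {}")
    case True
    then show ?thesis
    proof
      assume "A \<inter> nonzero M = {}"
      then have "variation M A y = 0" by (simp add: variation_eq_SUP bot_ennreal)
      with single show ?thesis by simp
    next
      assume "B \<inter> nonzero M = {}"
      then have "variation M B y = 0" by (simp add: variation_eq_SUP bot_ennreal)
      with single show ?thesis by simp
    qed
  next
    case False
    then have ne: "A \<inter> nonzero M \<noteq> {}" "B \<inter> nonzero M \<noteq> {}" by auto
    have "variation M A y + variation M B y
        = (SUP a\<in>A \<inter> nonzero M. ennreal ((a y / L2norm M a)\<^sup>2) + variation M B y)"
      unfolding variation_eq_SUP[of M A] by (rule ennreal_SUP_add_left[OF ne(1), symmetric])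
    also have "\<dots> = (SUP a\<in>A \<inter> nonzero M. SUP b\<in>B \<inter> nonzero M.
            ennreal ((a y / L2norm M a)\<^sup>2) + ennreal ((b y / L2norm M b)\<^sup>2))"
      unfolding variation_eq_SUP by (intro SUP_cong refl ennreal_SUP_add_right[OF ne(2)])
    also have "\<dots> \<le> ?K" using pair by (auto intro!: SUP_least)
    finally show ?thesis .
  qed
qed

text \<open>Independence passes to the squares, so the L2 norm is multiplicative on these products.
  It also gives their square integrability, since \<open>V\<close> need not be closed under
  multiplication.\<close>

lemma variation_times:
  assumes AV: "A \<subseteq> V" and BV: "B \<subseteq> V" and indep: "stoch_independent M A B"
  shows "variation M (A * B) y = variation M A y * variation M B y"
proof -
  have norm: "L2norm M (a * b) = L2norm M a * L2norm M b" and sq: "a * b \<in> square_integrable M"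
    if ab: "a \<in> A" "b \<in> B" for a b
  proof -
    have V: "a \<in> V" "b \<in> V" using ab AV BV by auto
    have "indep_var borel a borel b" using indep ab by (auto simp: stoch_independent_def)
    then have ind: "indep_var borel (\<lambda>x. (a x)\<^sup>2) borel (\<lambda>x. (b x)\<^sup>2)"
      using indep_var_compose[of borel a borel b "\<lambda>t. t\<^sup>2" borel "\<lambda>t. t\<^sup>2" borel] by (simp add: o_def)
    note int = V_square_integrable[OF V(1), THEN square_integrable_integrable]
      V_square_integrable[OF V(2), THEN square_integrable_integrable]
    show "L2norm M (a * b) = L2norm M a * L2norm M b"
      using indep_var_lebesgue_integral[OF ind int]
      by (simp add: L2norm_def power_mult_distrib real_sqrt_mult)
    have "(\<lambda>x. a x * b x) \<in> borel_measurable M"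
      by (intro borel_measurable_times V_measurable V)
    then show "a * b \<in> square_integrable M"
      using indep_var_integrable[OF ind int]
      by (simp add: square_integrable_def power_mult_distrib times_fun_def)
  qed
  have nz: "a * b \<in> nonzero M \<longleftrightarrow> a \<in> nonzero M \<and> b \<in> nonzero M" if ab: "a \<in> A" "b \<in> B" for a b
    using nonzero_iff[OF sq[OF ab]] V_nonzero_iff[of a] V_nonzero_iff[of b] ab AV BV
      L2norm_nonneg[of M a] L2norm_nonneg[of M b]
    by (auto simp: norm[OF ab] zero_less_mult_iff)
  \<comment> \<open>A product is nonzero exactly when both factors are, so the index set splits into
    the double supremum of \<open>variation_mult\<close>.\<close>
  have "(A * B) \<inter> nonzero M = (\<Union>a\<in>A \<inter> nonzero M. (\<lambda>b. a * b) ` (B \<inter> nonzero M))"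
    using nz by (fastforce simp: set_times_def)
  then have "variation M (A * B) y = (SUP a\<in>A \<inter> nonzero M. SUP b\<in>B \<inter> nonzero M.
      ennreal (((a * b) y / L2norm M (a * b))\<^sup>2))"
    by (simp add: variation_eq_SUP SUP_UNION image_comp o_def)
  also have "\<dots> = variation M A y * variation M B y"
    unfolding variation_mult by (intro SUP_cong refl) (simp add: norm)
  finally show ?thesis .
qed

end

subsection \<open>Tensor products\<close>

text \<open>For nonzero \<open>e\<close> this is the definition of the supremum. The point is that
  it extends to elements that vanish a.e., although no bounded point evaluation is
  available.\<close>

lemma sq_le_real_variation:
  assumes E: "subspace E" "E \<subseteq> square_integrable M" and ne: "E \<inter> nonzero M \<noteq> {}"
    and fin: "variation M E x < \<top>" and e: "e \<in> E"
  shows "(e x)\<^sup>2 \<le> real_variation M E x * (L2norm M e)\<^sup>2"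
proof -
  have bound: "(v x)\<^sup>2 \<le> real_variation M E x * (L2norm M v)\<^sup>2" if "v \<in> E" "v \<in> nonzero M" for v
    using real_variation_upper[OF fin that] nonzero_iff[of v M] that E(2)
    by (auto simp: power_divide pos_divide_le_eq)
  show ?thesis
  proof (cases "e \<in> nonzero M")
    case True
    with e show ?thesis by (rule bound)
  next
    case False
    txt \<open>If \<^term>\<open>e x \<noteq> 0\<close>, adding multiples of \<^term>\<open>e\<close> to a nonzero element of \<^term>\<open>E\<close> would make the variation
      at \<^term>\<open>x\<close> infinite.\<close>
    have e0: "L2norm M e = 0"
      using False nonzero_iff[of e M] e E(2) L2norm_nonneg[of M e] by auto
    obtain v where v: "v \<in> E" "v \<in> nonzero M" using ne by auto
    have vsq: "v \<in> square_integrable M" "e \<in> square_integrable M" using v e E by auto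
    define c where "c = real_variation M E x * (L2norm M v)\<^sup>2"
    have c: "0 \<le> c" by (simp add: c_def real_variation_def)
    have line: "(v x + t * e x)\<^sup>2 \<le> c" for t
    proof -
      have te: "t *\<^sub>R e \<in> E" using e E(1) subspace_scale by blast
      then have u: "v + t *\<^sub>R e \<in> E" using v(1) E(1) subspace_add by blast
      have "\<bar>\<integral>z. v z * (t *\<^sub>R e) z \<partial>M\<bar> \<le> L2norm M v * L2norm M (t *\<^sub>R e)"
        using te E(2) vsq by (intro L2_Cauchy_Schwarz) auto
      then have "(\<integral>z. v z * (t *\<^sub>R e) z \<partial>M) = 0" by (simp add: L2norm_scaleR e0)
      then have n: "(L2norm M (v + t *\<^sub>R e))\<^sup>2 = (L2norm M v)\<^sup>2"
        using L2norm_add_sq[of v M "t *\<^sub>R e"] te E(2) vsq by (auto simp: L2norm_scaleR e0)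
      then have "L2norm M (v + t *\<^sub>R e) = L2norm M v"
        using L2norm_nonneg by (metis power2_eq_imp_eq)
      then have "v + t *\<^sub>R e \<in> nonzero M"
        using v nonzero_iff[of v M] nonzero_iff[of "v + t *\<^sub>R e" M] u vsq E(2) by auto
      from bound[OF u this, unfolded n] show ?thesis by (simp add: c_def scaleR_fun_def)
    qed
    have "e x = 0"
    proof (rule ccontr)
      assume "e x \<noteq> 0"
      \<comment> \<open>This multiple of \<open>e\<close> moves the value at \<open>x\<close> to
        \<open>c + 1\<close>, whose square exceeds \<open>c\<close>.\<close>
      then have "(c + 1)\<^sup>2 \<le> c" using line[of "(c + 1 - v x) / e x"] by simp
      with c show False by (simp add: power2_eq_square algebra_simps) (smt (verit) mult_nonneg_nonneg)
    qed
    then show ?thesis by (simp add: real_variation_def)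
  qed
qed

context pair_sigma_finite
begin

lemma
  assumes "e \<in> square_integrable M1" "f \<in> square_integrable M2"
  shows square_integrable_product: "(\<lambda>(x, y). e x * f y) \<in> square_integrable (M1 \<Otimes>\<^sub>M M2)"
    and L2norm_product: "L2norm (M1 \<Otimes>\<^sub>M M2) (\<lambda>(x, y). e x * f y) = L2norm M1 e * L2norm M2 f"
proof -
  have [measurable]: "e \<in> borel_measurable M1" "f \<in> borel_measurable M2"
    using assms by (auto simp: square_integrable_def)
  note int = square_integrable_integrable[OF assms(1)] square_integrable_integrable[OF assms(2)]
  have "integrable (M1 \<Otimes>\<^sub>M M2) (\<lambda>p. (e (fst p))\<^sup>2 * (f (snd p))\<^sup>2)"
    using int by (intro Fubini_integrable) (auto intro!: AE_I2)
  then have int2: "integrable (M1 \<Otimes>\<^sub>M M2) (\<lambda>p. (case p of (x, y) \<Rightarrow> e x * f y)\<^sup>2)"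
    by (simp add: case_prod_beta power_mult_distrib)
  then show "(\<lambda>(x, y). e x * f y) \<in> square_integrable (M1 \<Otimes>\<^sub>M M2)"
    by (simp add: square_integrable_def)
  have "(\<integral>p. (case p of (x, y) \<Rightarrow> e x * f y)\<^sup>2 \<partial>(M1 \<Otimes>\<^sub>M M2)) = (\<integral>x. (e x)\<^sup>2 \<partial>M1) * (\<integral>y. (f y)\<^sup>2 \<partial>M2)"
    by (subst integral_fst'[OF int2, symmetric]) (simp add: power_mult_distrib)
  then show "L2norm (M1 \<Otimes>\<^sub>M M2) (\<lambda>(x, y). e x * f y) = L2norm M1 e * L2norm M2 f"
    by (simp add: L2norm_def real_sqrt_mult)
qed

section \<open>Slices and partial integrals of tensors\<close>

context
  fixes E F
  assumes E: "subspace E" "E \<subseteq> square_integrable M1" and F: "subspace F" "F \<subseteq> square_integrable M2"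
begin

lemma tensor_generator: "e \<in> E \<Longrightarrow> f \<in> F \<Longrightarrow> (\<lambda>(x, y). e x * f y) \<in> tensor E F"
  unfolding tensor_def by (rule span_base) blast

text \<open>Replaces induction over finite sums: a property is shown to define a subspace that
  contains the elementary tensors.\<close>

lemma tensor_induct:
  assumes "subspace U" "\<And>e f. e \<in> E \<Longrightarrow> f \<in> F \<Longrightarrow> (\<lambda>(x, y). e x * f y) \<in> U"
  shows "tensor E F \<subseteq> U"
  unfolding tensor_def using assms by (intro span_minimal) auto

lemma tensor_square_integrable: "tensor E F \<subseteq> square_integrable (M1 \<Otimes>\<^sub>M M2)"
  using E F by (intro tensor_induct subspace_square_integrable square_integrable_product) auto

lemma tensor_slice_snd: "u \<in> tensor E F \<Longrightarrow> (\<lambda>y. u (x, y)) \<in> F"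
proof -
  have "tensor E F \<subseteq> {u. (\<lambda>y. u (x, y)) \<in> F}"
  proof (intro tensor_induct subspaceI; clarsimp)
    show "(\<lambda>y. 0) \<in> F" using subspace_0[OF F(1)] by (simp add: zero_fun_def)
    show "(\<lambda>y. u (x, y) + v (x, y)) \<in> F" if "(\<lambda>y. u (x, y)) \<in> F" "(\<lambda>y. v (x, y)) \<in> F" for u v
      using subspace_add[OF F(1) that] by (simp add: plus_fun_def)
    show "(\<lambda>y. (c *\<^sub>R u) (x, y)) \<in> F" if "(\<lambda>y. u (x, y)) \<in> F" for c u
      using subspace_scale[OF F(1) that, of c] by (simp add: scaleR_fun_def)
    show "(\<lambda>y. e x * f y) \<in> F" if "f \<in> F" for e :: "'a \<Rightarrow> real" and f
      using subspace_scale[OF F(1) that, of "e x"] by (simp add: scaleR_fun_def)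
  qed
  then show "u \<in> tensor E F \<Longrightarrow> (\<lambda>y. u (x, y)) \<in> F" by auto
qed

lemma tensor_slice_fst: "u \<in> tensor E F \<Longrightarrow> (\<lambda>x. u (x, y)) \<in> E"
proof -
  have "tensor E F \<subseteq> {u. (\<lambda>x. u (x, y)) \<in> E}"
  proof (intro tensor_induct subspaceI; clarsimp)
    show "(\<lambda>x. 0) \<in> E" using subspace_0[OF E(1)] by (simp add: zero_fun_def)
    show "(\<lambda>x. u (x, y) + v (x, y)) \<in> E" if "(\<lambda>x. u (x, y)) \<in> E" "(\<lambda>x. v (x, y)) \<in> E" for u v
      using subspace_add[OF E(1) that] by (simp add: plus_fun_def)
    show "(\<lambda>x. (c *\<^sub>R u) (x, y)) \<in> E" if "(\<lambda>x. u (x, y)) \<in> E" for c u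
      using subspace_scale[OF E(1) that, of c] by (simp add: scaleR_fun_def)
    show "(\<lambda>x. e x * f y) \<in> E" if "e \<in> E" for e and f :: "'b \<Rightarrow> real"
      using subspace_scale[OF E(1) that, of "f y"] by (simp add: scaleR_fun_def mult.commute)
  qed
  then show "u \<in> tensor E F \<Longrightarrow> (\<lambda>x. u (x, y)) \<in> E" by auto
qed

text \<open>Pairing with \<open>g\<close> in the second variable is linear and sends an elementary
  tensor to a multiple of its factor in \<open>E\<close>.\<close>

lemma tensor_partial_integral:
  assumes g: "g \<in> square_integrable M2" and u: "u \<in> tensor E F"
  shows "(\<lambda>x. \<integral>z. u (x, z) * g z \<partial>M2) \<in> E"
proof -
  let ?I = "\<lambda>u x. \<integral>z. u (x, z) * g z \<partial>M2"
  have int: "integrable M2 (\<lambda>z. u (x, z) * g z)" if "u \<in> tensor E F" for u x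
    using square_integrable_mult[OF _ g] tensor_slice_snd[OF that, of x] F(2) by auto
  \<comment> \<open>Membership in the tensor product is carried along because additivity of the
    integral needs integrable slices.\<close>
  have "tensor E F \<subseteq> {u \<in> tensor E F. ?I u \<in> E}"
  proof (rule tensor_induct)
    have sub: "subspace (tensor E F)" by (simp add: tensor_def)
    show "subspace {u \<in> tensor E F. ?I u \<in> E}"
    proof (rule subspaceI)
      show "0 \<in> {u \<in> tensor E F. ?I u \<in> E}"
        using subspace_0[OF E(1)] subspace_0[OF sub] by (simp add: zero_fun_def)
      fix u v assume uv: "u \<in> {u \<in> tensor E F. ?I u \<in> E}" "v \<in> {u \<in> tensor E F. ?I u \<in> E}"
      have "?I (u + v) = ?I u + ?I v"
        using int[of u] int[of v] uv by (auto simp: fun_eq_iff distrib_right)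
      with uv show "u + v \<in> {u \<in> tensor E F. ?I u \<in> E}"
        using subspace_add[OF E(1)] subspace_add[OF sub] by simp
    next
      fix c u assume u: "u \<in> {u \<in> tensor E F. ?I u \<in> E}"
      have "?I (c *\<^sub>R u) = c *\<^sub>R ?I u" by (simp add: fun_eq_iff scaleR_fun_def mult.assoc)
      with u show "c *\<^sub>R u \<in> {u \<in> tensor E F. ?I u \<in> E}"
        using subspace_scale[OF E(1)] subspace_scale[OF sub] by simp
    qed
    fix e f assume ef: "e \<in> E" "f \<in> F"
    have "?I (\<lambda>(x, y). e x * f y) = (\<integral>z. f z * g z \<partial>M2) *\<^sub>R e"
      by (simp add: fun_eq_iff scaleR_fun_def mult.assoc mult.commute[of "\<integral>z. f z * g z \<partial>M2"])
    then show "(\<lambda>(x, y). e x * f y) \<in> {u \<in> tensor E F. ?I u \<in> E}"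
      using ef subspace_scale[OF E(1)] tensor_generator by simp
  qed
  with u show ?thesis by auto
qed

text \<open>For \<^term>\<open>g = (\<lambda>z. u (x, z))\<close> the function \<^term>\<open>\<lambda>x'. \<integral>z. u (x', z) * g z \<partial>M2\<close> lies in
  \<^term>\<open>E\<close>, takes the value \<^term>\<open>(L2norm M2 g)\<^sup>2\<close> at \<^term>\<open>x\<close>, and by Cauchy-Schwarz has norm at most
  \<^term>\<open>L2norm M2 g * L2norm (M1 \<Otimes>\<^sub>M M2) u\<close>. This replaces the choice of orthonormal bases.\<close>

lemma tensor_slice_bound:
  assumes k: "0 \<le> k" "\<And>e. e \<in> E \<Longrightarrow> (e x)\<^sup>2 \<le> k * (L2norm M1 e)\<^sup>2" and u: "u \<in> tensor E F"
  shows "(L2norm M2 (\<lambda>z. u (x, z)))\<^sup>2 \<le> k * (L2norm (M1 \<Otimes>\<^sub>M M2) u)\<^sup>2"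
proof -
  define g where "g = (\<lambda>z. u (x, z))"
  define h where "h = (\<lambda>x'. \<integral>z. u (x', z) * g z \<partial>M2)"
  define n where "n = L2norm M2 g"
  have g: "g \<in> square_integrable M2" using tensor_slice_snd[OF u] F(2) by (auto simp: g_def)
  have hE: "h \<in> E" using tensor_partial_integral[OF g u] by (simp add: h_def)
  have usq: "integrable (M1 \<Otimes>\<^sub>M M2) (\<lambda>p. (u p)\<^sup>2)"
    using tensor_square_integrable u square_integrable_integrable by blast
  have hx: "h x = n\<^sup>2" unfolding n_def L2norm_sq by (simp add: h_def g_def power2_eq_square)
  have "(L2norm M1 h)\<^sup>2 \<le> (\<integral>x'. n\<^sup>2 * (\<integral>z. (u (x', z))\<^sup>2 \<partial>M2) \<partial>M1)"
    unfolding L2norm_sq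
  proof (rule integral_mono)
    show "integrable M1 (\<lambda>x'. (h x')\<^sup>2)" using hE E(2) square_integrable_integrable by blast
    show "integrable M1 (\<lambda>x'. n\<^sup>2 * (\<integral>z. (u (x', z))\<^sup>2 \<partial>M2))"
      using integrable_fst'[OF usq] by simp
    fix x'
    have "\<bar>h x'\<bar> \<le> L2norm M2 (\<lambda>z. u (x', z)) * n"
      unfolding h_def n_def using tensor_slice_snd[OF u] F(2) by (intro L2_Cauchy_Schwarz g) auto
    then have "(h x')\<^sup>2 \<le> (L2norm M2 (\<lambda>z. u (x', z)) * n)\<^sup>2"
      by (rule power2_le_iff_abs_le[THEN iffD2, rotated]) (simp add: L2norm_nonneg n_def)
    then show "(h x')\<^sup>2 \<le> n\<^sup>2 * (\<integral>z. (u (x', z))\<^sup>2 \<partial>M2)"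
      by (simp add: power_mult_distrib L2norm_sq mult.commute)
  qed
  also have "\<dots> = n\<^sup>2 * (L2norm (M1 \<Otimes>\<^sub>M M2) u)\<^sup>2"
    using integral_fst'[OF usq] by (simp add: L2norm_sq)
  finally have "k * (L2norm M1 h)\<^sup>2 \<le> k * (n\<^sup>2 * (L2norm (M1 \<Otimes>\<^sub>M M2) u)\<^sup>2)"
    using k(1) by (rule mult_left_mono)
  \<comment> \<open>Here \<open>h x = n\<^sup>2\<close>, so the left side is
    \<open>(h x)\<^sup>2\<close>; one factor \<open>n\<^sup>2\<close> cancels unless it is
    0.\<close>
  with k(2)[OF hE] have le: "n\<^sup>2 * n\<^sup>2 \<le> n\<^sup>2 * (k * (L2norm (M1 \<Otimes>\<^sub>M M2) u)\<^sup>2)"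
    by (simp add: hx power2_eq_square[of "n\<^sup>2"] algebra_simps)
  have "n\<^sup>2 \<le> k * (L2norm (M1 \<Otimes>\<^sub>M M2) u)\<^sup>2"
  proof (cases "n = 0")
    case True
    then show ?thesis using k(1) by simp
  next
    case False
    then have "0 < n\<^sup>2" by simp
    from mult_le_cancel_left_pos[OF this] le show ?thesis by blast
  qed
  then show ?thesis by (simp add: n_def g_def)
qed

text \<open>Elementary tensors alone suffice, since their norms and their values both
  factorise.\<close>

lemma variation_tensor_ge:
  "variation M1 E x * variation M2 F y \<le> variation (M1 \<Otimes>\<^sub>M M2) (tensor E F) (x, y)"
  unfolding variation_mult
proof (intro SUP_least)
  fix e f assume ef: "e \<in> E \<inter> nonzero M1" "f \<in> F \<inter> nonzero M2"
  let ?u = "\<lambda>(x, y). e x * f y"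
  have sq: "e \<in> square_integrable M1" "f \<in> square_integrable M2" using ef E F by auto
  have "?u \<in> nonzero (M1 \<Otimes>\<^sub>M M2)"
    using nonzero_iff[OF sq(1)] nonzero_iff[OF sq(2)] nonzero_iff[OF square_integrable_product[OF sq]] ef
    by (simp add: L2norm_product[OF sq])
  from variation_upper[OF tensor_generator this, of "(x, y)"] ef
  show "ennreal ((e x * f y / (L2norm M1 e * L2norm M2 f))\<^sup>2)
      \<le> variation (M1 \<Otimes>\<^sub>M M2) (tensor E F) (x, y)"
    by (simp add: L2norm_product[OF sq])
qed

text \<open>Needed when one factor has only null elements; both sides of the product formula are
  then 0. Vanishing is expressed by the L2 norm, so the triangle inequality shows that the null
  functions form a subspace.\<close>

lemma tensor_null:
  assumes "E \<inter> nonzero M1 = {} \<or> F \<inter> nonzero M2 = {}"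
  shows "tensor E F \<inter> nonzero (M1 \<Otimes>\<^sub>M M2) = {}"
proof -
  let ?N = "M1 \<Otimes>\<^sub>M M2"
  let ?Z = "{u \<in> square_integrable ?N. L2norm ?N u = 0}"
  note sub = subspace_square_integrable[of ?N]
  have "tensor E F \<subseteq> ?Z"
  proof (rule tensor_induct)
    show "subspace ?Z"
    proof (rule subspaceI)
      show "0 \<in> ?Z" using subspace_0[OF sub] by (simp add: L2norm_def)
      show "u + v \<in> ?Z" if "u \<in> ?Z" "v \<in> ?Z" for u v
        using that L2norm_triangle[of u ?N v] L2norm_nonneg[of ?N "u + v"] subspace_add[OF sub] by auto
      show "c *\<^sub>R u \<in> ?Z" if "u \<in> ?Z" for c u
        using that subspace_scale[OF sub] by (simp add: L2norm_scaleR)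
    qed
    fix e f assume ef: "e \<in> E" "f \<in> F"
    then have sq: "e \<in> square_integrable M1" "f \<in> square_integrable M2" using E F by auto
    have "L2norm M1 e = 0 \<or> L2norm M2 f = 0"
      using assms ef nonzero_iff[OF sq(1)] nonzero_iff[OF sq(2)] L2norm_nonneg[of M1 e] L2norm_nonneg[of M2 f]
      by (auto simp: order_le_less)
    then show "(\<lambda>(x, y). e x * f y) \<in> ?Z"
      using square_integrable_product[OF sq] by (auto simp: L2norm_product[OF sq])
  qed
  then show ?thesis using nonzero_iff by fastforce
qed

lemma variation_tensor_le:
  "variation (M1 \<Otimes>\<^sub>M M2) (tensor E F) (x, y) \<le> variation M1 E x * variation M2 F y"
proof (cases "E \<inter> nonzero M1 = {} \<or> F \<inter> nonzero M2 = {}")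
  case True
  then show ?thesis using tensor_null by (simp add: variation_eq_SUP bot_ennreal)
next
  case False
  let ?N = "M1 \<Otimes>\<^sub>M M2"
  define K L where "K = real_variation M1 E x" and "L = real_variation M2 F y"
  have KL: "0 \<le> K" "0 \<le> L" by (simp_all add: K_def L_def real_variation_def)
  have boundE: "(e x)\<^sup>2 \<le> K * (L2norm M1 e)\<^sup>2" if "variation M1 E x < \<top>" "e \<in> E" for e
    unfolding K_def using False that by (intro sq_le_real_variation E) auto
  have boundF: "(f y)\<^sup>2 \<le> L * (L2norm M2 f)\<^sup>2" if "variation M2 F y < \<top>" "f \<in> F" for f
    unfolding L_def using False that by (intro sq_le_real_variation F) auto
  have zero: "variation ?N (tensor E F) (x, y) \<le> 0" if "\<And>u. u \<in> tensor E F \<Longrightarrow> u (x, y) = 0"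
    using that by (intro variation_least) simp
  \<comment> \<open>In the mixed cases the product is 0 * \<infinity> = 0, so the tensor side must
    vanish. Zero variation in one factor makes all its elements vanish at the given point, hence
    also every slice through it.\<close>
  consider "variation M1 E x < \<top>" "variation M2 F y < \<top>"
    | "variation M1 E x = 0" "variation M2 F y = \<top>"
    | "variation M1 E x = \<top>" "variation M2 F y = 0"
    | "variation M1 E x * variation M2 F y = \<top>"
    by (cases "variation M1 E x = \<top>"; cases "variation M2 F y = \<top>")
       (auto simp: ennreal_mult_eq_top_iff less_top[symmetric])
  then show ?thesis
  proof cases
    case 1
    have prod: "variation M1 E x * variation M2 F y = ennreal (K * L)"
      using 1 KL by (simp add: ennreal_mult K_def L_def real_variation_def)
    show ?thesis
      unfolding prod
    proof (intro variation_least ennreal_leI)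
      fix u assume u: "u \<in> tensor E F" "u \<in> nonzero ?N"
      have pos: "0 < L2norm ?N u" using nonzero_iff u tensor_square_integrable by blast
      have "(u (x, y))\<^sup>2 \<le> L * (L2norm M2 (\<lambda>z. u (x, z)))\<^sup>2"
        using boundF[OF 1(2) tensor_slice_snd[OF u(1), of x]] .
      also have "\<dots> \<le> L * (K * (L2norm ?N u)\<^sup>2)"
        by (intro mult_left_mono tensor_slice_bound KL boundE 1(1) u(1))
      finally show "(u (x, y) / L2norm ?N u)\<^sup>2 \<le> K * L"
        using pos by (simp add: power_divide pos_divide_le_eq mult_ac)
    qed
  next
    case 2
    then have "e x = 0" if "e \<in> E" for e
      using boundE[OF _ that] by (simp add: K_def real_variation_def)
    then have "u (x, y) = 0" if "u \<in> tensor E F" for u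
      using tensor_slice_fst[OF that, of y] by blast
    with zero show ?thesis by simp
  next
    case 3
    then have "f y = 0" if "f \<in> F" for f
      using boundF[OF _ that] by (simp add: L_def real_variation_def)
    then have "u (x, y) = 0" if "u \<in> tensor E F" for u
      using tensor_slice_snd[OF that, of x] by blast
    with zero show ?thesis by simp
  qed simp
qed

lemma variation_tensor:
  "variation (M1 \<Otimes>\<^sub>M M2) (tensor E F) (x, y) = variation M1 E x * variation M2 F y"
  by (rule antisym[OF variation_tensor_le variation_tensor_ge])

end

end

theorem theorem6:
  fixes M :: "'a measure" and w :: "'a \<Rightarrow> real"
    and V A B :: "('a \<Rightarrow> real) set" and \<A> :: "('a \<Rightarrow> real) set set"
    and M1 :: "'b measure" and w1 :: "'b \<Rightarrow> real" and E :: "('b \<Rightarrow> real) set"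
    and M2 :: "'c measure" and w2 :: "'c \<Rightarrow> real" and F :: "('c \<Rightarrow> real) set"
  assumes "prob_space M" "weight M w" "evaluation_space M w V"
    and "A \<subseteq> V" "B \<subseteq> V" "\<A> \<subseteq> Pow V"
    and "prob_space M1" "weight M1 w1" "E \<subseteq> weighted_space M1 w1"
    and "prob_space M2" "weight M2 w2" "F \<subseteq> weighted_space M2 w2"
  shows
    \<comment> \<open>1\<close>
    "(\<forall>y\<in>space M. variation M (\<Union>\<A>) y = (SUP A\<in>\<A>. variation M A y)) \<and>
    \<comment> \<open>2\<close>
     (\<forall>y\<in>space M. variation M A y =
        variation M (pm_topology V (weighted_dist M w) closure_of A) y) \<and>
    \<comment> \<open>3\<close>
     (let D = {A. A \<noteq> {} \<and> A \<subseteq> V \<inter> nonzero M \<and>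
                  compactin (pm_topology V (weighted_dist M w)) A} in
        (\<forall>A\<in>D. admissible M w A) \<and>
        continuous_map
          (pm_topology D (hausdorff_dist (weighted_dist M w)))
          (pm_topology (weighted_space M (\<lambda>y. (w y)\<^sup>2)) (weighted_dist M (\<lambda>y. (w y)\<^sup>2)))
          (real_variation M)) \<and>
    \<comment> \<open>4\<close>
     (\<forall>r>0. continuous_map
          (pm_topology {A. A \<subseteq> V - {v. L2norm M v < r} \<and> admissible M w A}
             (hausdorff_dist (weighted_dist M w)))
          (pm_topology (weighted_space M (\<lambda>y. (w y)\<^sup>2)) (weighted_dist M (\<lambda>y. (w y)\<^sup>2)))
          (real_variation M)) \<and>
    \<comment> \<open>5\<close>
     continuous_map
       (pm_topology {A. A \<subseteq> V \<and> open_cone A \<and> admissible M w A}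
          (truncated_hausdorff_dist M (weighted_dist M w)))
       (pm_topology (weighted_space M (\<lambda>y. (w y)\<^sup>2)) (weighted_dist M (\<lambda>y. (w y)\<^sup>2)))
       (real_variation M) \<and>
    \<comment> \<open>6\<close>
     (L2_orthogonal M A B \<longrightarrow>
        (\<forall>y\<in>space M. variation M (A + B) y \<le> variation M A y + variation M B y) \<and>
        (subspace A \<and> subspace B \<longrightarrow>
           (\<forall>y\<in>space M. variation M (A + B) y = variation M A y + variation M B y))) \<and>
    \<comment> \<open>7\<close>
     (stoch_independent M A B \<longrightarrow>
        (\<forall>y\<in>space M. variation M (A * B) y = variation M A y * variation M B y)) \<and>
    \<comment> \<open>8\<close>
     (subspace E \<and> subspace F \<longrightarrow>
        (\<forall>x\<in>space M1. \<forall>y\<in>space M2.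
           variation (M1 \<Otimes>\<^sub>M M2) (tensor E F) (x, y) = variation M1 E x * variation M2 F y))"
proof -
  interpret point_evaluation_space M w V
    by (intro point_evaluation_space.intro weighted_prob_space.intro weighted_prob_space_axioms.intro
        point_evaluation_space_axioms.intro assms)
  interpret W1: weighted_prob_space M1 w1
    by (intro weighted_prob_space.intro weighted_prob_space_axioms.intro assms)
  interpret W2: weighted_prob_space M2 w2
    by (intro weighted_prob_space.intro weighted_prob_space_axioms.intro assms)
  interpret P: pair_sigma_finite M1 M2 ..
  \<comment> \<open>The weights of the two factors supply exactly the square integrability on which
    the tensor statement rests.\<close>
  have sq: "E \<subseteq> square_integrable M1" "F \<subseteq> square_integrable M2"
    using assms W1.weighted_space_square_integrable W2.weighted_space_square_integrable by auto
  show ?thesis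
    unfolding Let_def
  proof (intro conjI ballI allI impI)
    show "variation M (\<Union>\<A>) y = (SUP A\<in>\<A>. variation M A y)" for y
      by (rule variation_Union)
    show "variation M A y = variation M (pm_topology V (weighted_dist M w) closure_of A) y"
      if "y \<in> space M" for y
      using variation_closure_of[OF that \<open>A \<subseteq> V\<close>] by simp
    show "admissible M w A"
      if "A \<in> {A. A \<noteq> {} \<and> A \<subseteq> V \<inter> nonzero M \<and> compactin (pm_topology V (weighted_dist M w)) A}" for A
      using that by (intro compact_admissible) auto
    show "continuous_map
        (pm_topology {A. A \<noteq> {} \<and> A \<subseteq> V \<inter> nonzero M \<and> compactin (pm_topology V (weighted_dist M w)) A}
          (hausdorff_dist (weighted_dist M w)))
        (pm_topology (weighted_space M (\<lambda>y. (w y)\<^sup>2)) (weighted_dist M (\<lambda>y. (w y)\<^sup>2)))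
        (real_variation M)"
      by (rule continuous_map_real_variation_compact)
    show "continuous_map
        (pm_topology {A. A \<subseteq> V - {v. L2norm M v < r} \<and> admissible M w A}
          (hausdorff_dist (weighted_dist M w)))
        (pm_topology (weighted_space M (\<lambda>y. (w y)\<^sup>2)) (weighted_dist M (\<lambda>y. (w y)\<^sup>2)))
        (real_variation M)" if "0 < r" for r
      using that by (rule continuous_map_real_variation_away_from_0)
    show "continuous_map
        (pm_topology {A. A \<subseteq> V \<and> open_cone A \<and> admissible M w A}
          (truncated_hausdorff_dist M (weighted_dist M w)))
        (pm_topology (weighted_space M (\<lambda>y. (w y)\<^sup>2)) (weighted_dist M (\<lambda>y. (w y)\<^sup>2)))
        (real_variation M)"
      by (rule continuous_map_real_variation_cones)
    show sum: "variation M (A + B) y \<le> variation M A y + variation M B y"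
      if "L2_orthogonal M A B" "y \<in> space M" for y
      using assms that by (intro variation_add_le)
    show "variation M (A + B) y = variation M A y + variation M B y"
      if "L2_orthogonal M A B" "subspace A \<and> subspace B" "y \<in> space M" for y
      using assms that by (intro antisym sum variation_add_ge) auto
    show "variation M (A * B) y = variation M A y * variation M B y"
      if "stoch_independent M A B" for y
      using assms that by (intro variation_times)
    show "variation (M1 \<Otimes>\<^sub>M M2) (tensor E F) (x, y) = variation M1 E x * variation M2 F y"
      if "subspace E \<and> subspace F" for x y
      using sq that by (intro P.variation_tensor) auto
  qed
qed

end
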